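(* There exists an absolute constant $c>0$ with the following property. Let $p$ be a prime and let $A,B\subseteq \mathbb{Z}/p\mathbb{Z}$ satisfy $1<|A|<p/2$, $B\cap(-B)=\varnothing$, and $|B|<\min\{c|A|/\ln|A|,\sqrt{p/8}\}$. Then $\mu_A(B)\ge |B|$.
   Context: $\mathbb{Z}/p\mathbb{Z}$ denotes the cyclic group of prime order $p$. For a finite subset $A$ and an element $b$ of an abelian group, $\Delta_A(b):=|(A+b)\setminus A|$, and for a finite subset $B$ of the group, $\mu_A(B):=\max_{b\in B}\Delta_A(b)$ (with the convention that the maximum over the empty set is $0$). Here $-B=\{-b: b\in B\}$ and $\ln$ is the natural logarithm. *)

theory Defs
  imports Complex_Main "HOL-Computational_Algebra.Primes" "HOL-Algebra.Elementary_Groups"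
begin

(* Groups are written multiplicatively in HOL-Algebra: the translate A + b is the coset
   A #>\<^bsub>G\<^esub> b, and -B is set_inv\<^bsub>G\<^esub> B. *)

definition shift_delta :: "('a, 'm) monoid_scheme \<Rightarrow> 'a set \<Rightarrow> 'a \<Rightarrow> nat" where
  "shift_delta G A b = card ((A #>\<^bsub>G\<^esub> b) - A)"

(* Only meaningful for finite A and B. *)
definition shift_mu :: "('a, 'm) monoid_scheme \<Rightarrow> 'a set \<Rightarrow> 'a set \<Rightarrow> nat" where
  "shift_mu G A B = (if B = {} then 0 else Max (shift_delta G A ` B))"

end

theory Submission
  imports Defs
begin

text \<open>
  Let \<open>n = |B|\<close>, \<open>D = B \<union> -B \<union> {0}\<close>, and suppose \<open>\<Delta>\<^sub>A < n\<close> on \<open>B\<close>. Since \<open>\<Delta>\<^sub>A\<close> is subadditive,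
  \<open>\<Delta>\<^sub>A \<le> k n\<close> on \<open>k D\<close>; comparing with \<open>\<Sum>\<^sub>b (|A| - \<Delta>\<^sub>A(b)) = |A|\<^sup>2\<close> and using Cauchy-Davenport
  bounds the doubling of \<open>D\<close> by a constant close to \<open>2\<close>. The squared Fourier coefficients of \<open>A\<close> provide a
  dilation concentrating most of \<open>D\<close> near \<open>0\<close>, so integer arguments apply and show that, after
  dilation, \<open>D\<close> lies in an interval \<open>[-q, q]\<close> with \<open>q \<le> 7n/5\<close>. As \<open>p > 8n\<^sup>2\<close>, the set \<open>A\<close> then has a gap
  of length \<open>q\<close>, and the problem becomes one about sets of integers.

  For integers, choose \<open>q = max D\<close> and cut \<open>A\<close> at its median \<open>w\<close>. Let \<open>f(r)\<close> be the number of elements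
  of \<open>A\<close> above \<open>w\<close> in the class \<open>r\<close> modulo \<open>q\<close>, and \<open>\<tau>\<close> the number of elements missing from the window
  \<open>[w, w + q)\<close>. If \<open>x \<in> D\<close> is positive, then \<open>\<Delta>\<^sub>A(x) < n\<close> forces \<open>f\<close> to grow slowly,
  \<open>\<Sum>\<^sub>r (f(r + x) - f(r) - 1)\<^sub>+ \<le> q - x + \<tau>\<close>, while above or below the window at least \<open>\<tau>/2\<close> classes are
  empty. Starting from these classes and multiplying the scale by \<open>3\<close>, the average of \<open>f\<close> increases by
  at most \<open>7\<close> in each step, so half of \<open>A\<close> has only \<open>O(n ln n)\<close> elements.
\<close>

subsection \<open>Spreading of residue class counts\<close>

lemma bij_betw_add_mod:
  fixes q x :: int
  assumes "q > 0"
  shows "bij_betw (\<lambda>r. (r + x) mod q) {0..<q} {0..<q}"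
  by (rule bij_betw_byWitness[where f' = "\<lambda>r. (r - x) mod q"])
    (use assms in \<open>auto simp: mod_simps\<close>)

lemma sum_add_mod:
  fixes q x :: int and g :: "int \<Rightarrow> 'a::comm_monoid_add"
  assumes "q > 0"
  shows "(\<Sum>r\<in>{0..<q}. g ((r + x) mod q)) = (\<Sum>r\<in>{0..<q}. g r)"
  by (rule sum.reindex_bij_betw[OF bij_betw_add_mod[OF assms]])

lemma card_eq_sum_mod:
  fixes q :: int
  assumes "q > 0" "finite S"
  shows "card S = (\<Sum>r\<in>{0..<q}. card {a \<in> S. a mod q = r})"
proof -
  have "S = (\<Union>r\<in>{0..<q}. {a \<in> S. a mod q = r})"
    using assms(1) by auto
  then have "card S = card (\<Union>r\<in>{0..<q}. {a \<in> S. a mod q = r})"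
    by simp
  also have "\<dots> = (\<Sum>r\<in>{0..<q}. card {a \<in> S. a mod q = r})"
    by (rule card_UN_disjoint) (use assms(2) in auto)
  finally show ?thesis .
qed

text \<open>The function \<open>f\<close> of the overview, with the cut moved to \<open>0\<close> by
  translation or reflection. It is integer-valued because differences of class counts may be
  negative.\<close>

definition upper_class :: "int set \<Rightarrow> int \<Rightarrow> int \<Rightarrow> int" where
  "upper_class A q r = int (card {a \<in> A. 0 \<le> a \<and> a mod q = r})"

lemma upper_class_nonneg: "0 \<le> upper_class A q r"
  by (simp add: upper_class_def)

lemma sum_upper_class:
  assumes "finite A" "q > 0"
  shows "(\<Sum>r\<in>{0..<q}. upper_class A q r) = int (card {a \<in> A. 0 \<le> a})"
proof -
  have "card {a \<in> A. 0 \<le> a} = (\<Sum>r\<in>{0..<q}. card {a \<in> {a \<in> A. 0 \<le> a}. a mod q = r})"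
    by (rule card_eq_sum_mod) (use assms in auto)
  then show ?thesis
    by (simp add: upper_class_def conj_assoc)
qed

text \<open>Translation by \<open>x\<close> maps the elements of class \<open>r\<close> that stay in
  \<open>A\<close> injectively into class \<open>r'\<close>. All images are at least
  \<open>x\<close>, so \<open>r'\<close> itself, if it is an element of \<open>A\<close> below
  \<open>x\<close>, is missed; this is the extra unit.\<close>

lemma upper_class_exits:
  fixes A :: "int set" and q x r :: int
  assumes "finite A" "0 < x" "x \<le> q" "r \<in> {0..<q}"
  defines "r' \<equiv> (r + x) mod q"
  shows "upper_class A q r - upper_class A q r' + of_bool (r' < x \<and> r' \<in> A)
     \<le> int (card {a \<in> A. 0 \<le> a \<and> a mod q = r \<and> a + x \<notin> A})"
proof -
  define P where "P = {a \<in> A. 0 \<le> a \<and> a mod q = r}"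
  define P' where "P' = {a \<in> A. 0 \<le> a \<and> a mod q = r'}"
  define Q where "Q = {a \<in> P. a + x \<notin> A}"
  have fin: "finite P" "finite P'" "finite Q"
    using assms(1) by (auto simp: P_def P'_def Q_def)
  have r': "0 \<le> r'" "r' < q" "r' mod q = r'"
    using assms(2,3) by (simp_all add: r'_def)
  have sub: "(\<lambda>a. a + x) ` (P - Q) \<subseteq> P' - (if r' < x \<and> r' \<in> A then {r'} else {})"
  proof
    fix b assume "b \<in> (\<lambda>a. a + x) ` (P - Q)"
    then obtain a where a: "a \<in> A" "0 \<le> a" "a mod q = r" "a + x \<in> A" "b = a + x"
      by (auto simp: P_def Q_def)
    have "b mod q = r'" unfolding a(5) r'_def a(3)[symmetric] by (simp add: mod_add_left_eq)
    moreover have "b \<noteq> r'" if "r' < x" using that a(2,5) by simp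
    ultimately show "b \<in> P' - (if r' < x \<and> r' \<in> A then {r'} else {})"
      using a assms(2) by (simp add: P'_def)
  qed
  have "card (P - Q) = card ((\<lambda>a. a + x) ` (P - Q))"
    by (simp add: card_image)
  also have "\<dots> \<le> card (P' - (if r' < x \<and> r' \<in> A then {r'} else {}))"
    by (rule card_mono[OF _ sub]) (use fin in auto)
  also have "\<dots> = card P' - of_bool (r' < x \<and> r' \<in> A)"
    using r' fin by (auto simp: P'_def)
  finally have 1: "card (P - Q) \<le> card P' - of_bool (r' < x \<and> r' \<in> A)" .
  have 2: "card (P - Q) = card P - card Q" "card Q \<le> card P"
    using fin by (auto simp: Q_def intro!: card_Diff_subset card_mono)
  have 3: "of_bool (r' < x \<and> r' \<in> A) \<le> card P'"
    using r' fin by (auto simp: P'_def of_bool_def card_gt_0_iff Suc_le_eq)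
  have "int (card P) - int (card P') + of_bool (r' < x \<and> r' \<in> A) \<le> int (card Q)"
    using 1 2 3 by (cases "r' < x \<and> r' \<in> A") (auto split: if_splits)
  moreover have "Q = {a \<in> A. 0 \<le> a \<and> a mod q = r \<and> a + x \<notin> A}"
    by (auto simp: P_def Q_def)
  ultimately show ?thesis
    by (simp add: upper_class_def P_def P'_def)
qed

text \<open>The summand \<open>- 1\<close> is the gain from cutting \<open>A\<close> at \<open>0\<close>: a shifted
  element cannot fall into the first window \<open>{0..<x}\<close>, so a class meeting that window
  receives at most all but one of its elements.\<close>

lemma upper_class_excess:
  fixes A :: "int set" and q x :: int
  assumes "finite A" "0 < x" "x \<le> q"
  shows "(\<Sum>r\<in>{0..<q}. max 0 (upper_class A q ((r + x) mod q) - upper_class A q r - 1))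
    \<le> int (card {a \<in> A. 0 \<le> a \<and> a + x \<notin> A}) - int (card (A \<inter> {0..<x}))"
proof -
  let ?f = "upper_class A q"
  define e :: "int \<Rightarrow> int" where "e r = of_bool (r < x \<and> r \<in> A)" for r
  have q: "q > 0" using assms by simp
  \<comment> \<open>If the maximum is positive, it cancels the difference and leaves
    \<open>e ((r + x) mod q) - 1\<close>, which is at most \<open>0\<close>. Otherwise this is
    \<open>upper_class_exits\<close>.\<close>
  have "?f r - ?f ((r + x) mod q) + e ((r + x) mod q)
          + max 0 (?f ((r + x) mod q) - ?f r - 1)
        \<le> int (card {a \<in> A. 0 \<le> a \<and> a mod q = r \<and> a + x \<notin> A})" if "r \<in> {0..<q}" for r
  proof -
    have "e ((r + x) mod q) \<le> 1" by (simp add: e_def)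
    moreover have "0 \<le> int (card {a \<in> A. 0 \<le> a \<and> a mod q = r \<and> a + x \<notin> A})" by simp
    ultimately show ?thesis
      using upper_class_exits[OF assms that] unfolding e_def by linarith
  qed
  then have "(\<Sum>r\<in>{0..<q}. ?f r - ?f ((r + x) mod q) + e ((r + x) mod q)
          + max 0 (?f ((r + x) mod q) - ?f r - 1))
     \<le> (\<Sum>r\<in>{0..<q}. int (card {a \<in> A. 0 \<le> a \<and> a mod q = r \<and> a + x \<notin> A}))"
    by (rule sum_mono)
  also have "\<dots> = int (card {a \<in> A. 0 \<le> a \<and> a + x \<notin> A})"
  proof -
    have "card {a \<in> A. 0 \<le> a \<and> a + x \<notin> A}
        = (\<Sum>r\<in>{0..<q}. card {a \<in> {a \<in> A. 0 \<le> a \<and> a + x \<notin> A}. a mod q = r})"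
      by (rule card_eq_sum_mod) (use assms in auto)
    moreover have "{a \<in> {a \<in> A. 0 \<le> a \<and> a + x \<notin> A}. a mod q = r}
        = {a \<in> A. 0 \<le> a \<and> a mod q = r \<and> a + x \<notin> A}" for r by auto
    ultimately show ?thesis by simp
  qed
  \<comment> \<open>The differences of \<open>?f\<close> cancel in the sum, since adding
    \<open>x\<close> permutes the classes modulo \<open>q\<close>.\<close>
  finally have "(\<Sum>r\<in>{0..<q}. e r)
      + (\<Sum>r\<in>{0..<q}. max 0 (?f ((r + x) mod q) - ?f r - 1))
      \<le> int (card {a \<in> A. 0 \<le> a \<and> a + x \<notin> A})"
    by (simp add: sum.distrib sum_subtractf sum_add_mod[OF q, of ?f] sum_add_mod[OF q, of e])
  moreover have "(\<Sum>r\<in>{0..<q}. e r) = int (card (A \<inter> {0..<x}))"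
  proof -
    have "(\<Sum>r\<in>{0..<q}. e r) = (\<Sum>r\<in>{r\<in>{0..<q}. r < x \<and> r \<in> A}. 1)"
      unfolding e_def by (simp add: sum.If_cases of_bool_def Int_def)
    also have "{r\<in>{0..<q}. r < x \<and> r \<in> A} = A \<inter> {0..<x}"
      using assms by auto
    finally show ?thesis by simp
  qed
  ultimately show ?thesis by simp
qed

lemma int_window_eqI:
  fixes x y q :: int
  assumes "q dvd x - y" "x \<in> {1..q}" "y \<in> {1..q}"
  shows "x = y"
proof (rule ccontr)
  assume "x \<noteq> y"
  moreover have "\<bar>x - y\<bar> < q" using assms(2,3) by auto
  ultimately show False using assms(1) dvd_imp_le_int[of "x - y" q] by simp
qed

text \<open>For fixed \<open>x\<close>, each value at \<open>u + x\<close> is at most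
  \<open>F u + 1\<close> plus its excess. The excesses over \<open>U\<close> are part of the total
  over all classes, which is at most \<open>Y + \<tau>\<close> for shifts within \<open>Y\<close> of
  \<open>q\<close>.\<close>

lemma spread_sum:
  fixes F :: "int \<Rightarrow> int" and q \<tau> Y :: int
  assumes q: "q > 0"
    and ex: "\<And>x. x \<in> X \<Longrightarrow> (\<Sum>r\<in>{0..<q}. max 0 (F ((r + x) mod q) - F r - 1)) \<le> q - x + \<tau>"
    and XY: "XY \<subseteq> X" "\<And>x. x \<in> XY \<Longrightarrow> q - x \<le> Y"
    and U: "U \<subseteq> {0..<q}"
  shows "(\<Sum>u\<in>U. \<Sum>x\<in>XY. F ((u + x) mod q))
    \<le> int (card XY) * ((\<Sum>u\<in>U. F u) + int (card U) + Y + \<tau>)"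
proof -
  have "(\<Sum>u\<in>U. \<Sum>x\<in>XY. F ((u + x) mod q)) = (\<Sum>x\<in>XY. \<Sum>u\<in>U. F ((u + x) mod q))"
    by (rule sum.swap)
  also have "\<dots> \<le> (\<Sum>x\<in>XY. (\<Sum>u\<in>U. F u) + int (card U) + Y + \<tau>)"
  proof (rule sum_mono)
    fix x assume x: "x \<in> XY"
    have "(\<Sum>u\<in>U. F ((u + x) mod q))
        \<le> (\<Sum>u\<in>U. F u + 1 + max 0 (F ((u + x) mod q) - F u - 1))"
      by (rule sum_mono) auto
    also have "\<dots> = (\<Sum>u\<in>U. F u) + int (card U)
        + (\<Sum>u\<in>U. max 0 (F ((u + x) mod q) - F u - 1))"
      by (simp add: sum.distrib)
    also have "(\<Sum>u\<in>U. max 0 (F ((u + x) mod q) - F u - 1))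
        \<le> (\<Sum>u\<in>{0..<q}. max 0 (F ((u + x) mod q) - F u - 1))"
      by (rule sum_mono2) (use U in auto)
    also have "\<dots> \<le> q - x + \<tau>" using ex x XY by blast
    also have "\<dots> \<le> Y + \<tau>" using XY(2)[OF x] by simp
    finally show "(\<Sum>u\<in>U. F ((u + x) mod q)) \<le> (\<Sum>u\<in>U. F u) + int (card U) + Y + \<tau>"
      by simp
  qed
  finally show ?thesis by simp
qed

text \<open>Averaging over \<open>u\<close> in \<open>U\<close> yields one \<open>u\<close> for
  which the classes \<open>u + x\<close>, with \<open>x\<close> in \<open>X\<close> within
  \<open>Y\<close> of \<open>q\<close>, have average at most \<open>a + 7\<close>: one unit comes
  from the \<open>+ 1\<close> per class, six from \<open>Y + \<tau>\<close>. At most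
  \<open>q - Y\<close> elements of \<open>X\<close> are too small to be used.\<close>

lemma spread_step:
  fixes F :: "int \<Rightarrow> int" and q \<tau> Y a :: int
  assumes q: "q > 0" 
    and X: "X \<subseteq> {1..q}" "card X = n"
    and ex: "\<And>x. x \<in> X \<Longrightarrow> (\<Sum>r\<in>{0..<q}. max 0 (F ((r + x) mod q) - F r - 1)) \<le> q - x + \<tau>"
    and U: "U \<subseteq> {0..<q}" "U \<noteq> {}" "(\<Sum>u\<in>U. F u) \<le> a * int (card U)"
    and Y: "0 \<le> Y" "Y \<le> q" "Y + \<tau> \<le> 6 * int (card U)"
  shows "\<exists>U'\<subseteq>{0..<q}. int (card U') \<ge> Y + int n - q \<and> (\<Sum>u\<in>U'. F u) \<le> (a + 7) * int (card U')"
proof -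
  define XY where "XY = {x \<in> X. q - x < Y}"
  have fX: "finite X" using X(1) finite_subset by blast
  have fU: "finite U" using U(1) finite_subset by blast
  have cU: "card U > 0" using U(2) fU by auto
  have cXY: "int (card XY) \<ge> Y + int n - q"
  proof -
    have "X - XY \<subseteq> {1..q - Y}" using X(1) by (auto simp: XY_def)
    then have "card (X - XY) \<le> card {1..q - Y}" by (intro card_mono) auto
    then have "int (card (X - XY)) \<le> q - Y" using Y by simp
    moreover have "card (X - XY) = n - card XY" "card XY \<le> n"
      using fX X(2) by (auto simp: XY_def intro!: card_Diff_subset card_mono)
    ultimately show ?thesis by linarith
  qed
  have "(\<Sum>u\<in>U. \<Sum>x\<in>XY. F ((u + x) mod q))
      \<le> int (card XY) * ((\<Sum>u\<in>U. F u) + int (card U) + Y + \<tau>)"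
    by (rule spread_sum[OF q ex]) (use U in \<open>auto simp: XY_def\<close>)
  also have "\<dots> \<le> int (card XY) * ((a + 7) * int (card U))"
    by (rule mult_left_mono) (use U Y in \<open>auto simp: algebra_simps\<close>)
  also have "\<dots> = (\<Sum>u\<in>U. int (card XY) * (a + 7))"
    by simp
  finally obtain u where u: "u \<in> U" "(\<Sum>x\<in>XY. F ((u + x) mod q)) \<le> int (card XY) * (a + 7)"
    using sum_strict_mono[OF fU U(2), of "\<lambda>_. int (card XY) * (a + 7)"]
    by (meson not_less)
  have inj: "inj_on (\<lambda>x. (u + x) mod q) XY"
  proof (rule inj_onI)
    fix x y assume xy: "x \<in> XY" "y \<in> XY" "(u + x) mod q = (u + y) mod q"
    then have "q dvd (x - y)" by (simp add: mod_eq_dvd_iff)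
    then show "x = y" by (rule int_window_eqI) (use xy X(1) in \<open>auto simp: XY_def\<close>)
  qed
  let ?U = "(\<lambda>x. (u + x) mod q) ` XY"
  have "?U \<subseteq> {0..<q}" using q by auto
  moreover have "card ?U = card XY" using inj by (rule card_image)
  moreover have "(\<Sum>u\<in>?U. F u) = (\<Sum>x\<in>XY. F ((u + x) mod q))"
    using inj by (simp add: sum.reindex)
  ultimately show ?thesis using u(2) cXY by (intro exI[of _ ?U]) (auto simp: mult.commute)
qed

text \<open>Starting from empty classes, each application of \<open>spread_step\<close> triples the
  set and raises the average by \<open>7\<close>, until \<open>n\<close> classes are reached. A set
  of \<open>n\<close> classes translated by \<open>X\<close> covers every class many times, which
  bounds the total of \<open>F\<close>.\<close>

lemma spread_bound:
  fixes F :: "int \<Rightarrow> int" and q \<tau> :: int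
  assumes q: "q > 0"
    and X: "X \<subseteq> {1..q}" "card X = n"
    and ex: "\<And>x. x \<in> X \<Longrightarrow> (\<Sum>r\<in>{0..<q}. max 0 (F ((r + x) mod q) - F r - 1)) \<le> q - x + \<tau>"
    and F: "\<And>r. F r \<ge> 0"
    and U: "U0 \<subseteq> {0..<q}" "U0 \<noteq> {}" "\<And>u. u \<in> U0 \<Longrightarrow> F u = 0"
    and cU: "\<tau> \<le> 2 * int (card U0)" "q - int n \<le> int (card U0)"
    and \<tau>: "0 \<le> \<tau>" "\<tau> \<le> q" and qn: "2 * q \<le> 3 * int n" and k: "n \<le> 3 ^ k"
  shows "(\<Sum>r\<in>{0..<q}. F r) \<le> 2 * q * (7 * int k + 3)"
proof -
  have nq: "int n \<le> q"
  proof -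
    have "card X \<le> card {1..q}" using X by (intro card_mono) auto
    then show ?thesis using X q by simp
  qed
  have n0: "n > 0" using qn q by simp
  have "\<exists>U\<subseteq>{0..<q}. U \<noteq> {} \<and> \<tau> \<le> 2 * int (card U) \<and> q - int n \<le> int (card U) \<and>
      min (3 ^ j) (int n) \<le> int (card U) \<and> (\<Sum>u\<in>U. F u) \<le> 7 * int j * int (card U)" for j
  proof (induction j)
    case 0
    have "card U0 > 0" using U(1,2) finite_subset by fastforce
    then show ?case using U cU by (intro exI[of _ U0]) auto
  next
    case (Suc j)
    then obtain U where U: "U \<subseteq> {0..<q}" "U \<noteq> {}" "\<tau> \<le> 2 * int (card U)"
      "q - int n \<le> int (card U)" "min (3 ^ j) (int n) \<le> int (card U)"
      "(\<Sum>u\<in>U. F u) \<le> 7 * int j * int (card U)" by blast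
    \<comment> \<open>The factor \<open>4\<close> loses at most \<open>q - n \<le> card U\<close>
      and so leaves a factor \<open>3\<close>. Together with \<open>\<tau> \<le> 2 * card U\<close>
      it meets the limit \<open>6 * card U\<close> of \<open>spread_step\<close>.\<close>
    define Y where "Y = min (4 * int (card U)) q"
    have "\<exists>U'\<subseteq>{0..<q}. int (card U') \<ge> Y + int n - q \<and>
        (\<Sum>u\<in>U'. F u) \<le> (7 * int j + 7) * int (card U')"
      by (rule spread_step[OF q X ex U(1,2,6)]) (use U q in \<open>auto simp: Y_def\<close>)
    then obtain U' where U': "U' \<subseteq> {0..<q}" "int (card U') \<ge> Y + int n - q"
      "(\<Sum>u\<in>U'. F u) \<le> (7 * int j + 7) * int (card U')" by blast
    have c: "int (card U') \<ge> min (3 * int (card U)) (int n)"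
      using U'(2) U(4) by (auto simp: Y_def min_def split: if_splits)
    have "card U > 0" using U(1,2) finite_subset by fastforce
    with c n0 have "U' \<noteq> {}" by auto
    moreover have "\<tau> \<le> 2 * int (card U')" "q - int n \<le> int (card U')"
      using c U(3,4) \<tau> qn by (auto simp: min_def split: if_splits)
    moreover have "min (3 ^ Suc j) (int n) \<le> int (card U')"
      using c U(5) by (simp only: power_Suc)
    ultimately show ?case using U' by (intro exI[of _ U']) (auto simp: algebra_simps)
  qed
  from this[of k] obtain U where "U \<subseteq> {0..<q}" "min (3 ^ k) (int n) \<le> int (card U)"
      "(\<Sum>u\<in>U. F u) \<le> 7 * int k * int (card U)" by blast
  moreover have "int n \<le> 3 ^ k" using of_nat_mono[OF k, where 'a = int] by simp
  ultimately have U: "U \<subseteq> {0..<q}" "int n \<le> int (card U)"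
      "(\<Sum>u\<in>U. F u) \<le> 7 * int k * int (card U)"
    by simp_all
  have cUq: "int (card U) \<le> q"
    using card_mono[OF _ U(1)] q by simp
  have fU: "finite U" and fX: "finite X" using U(1) X(1) finite_subset by blast+
  \<comment> \<open>Pigeonhole among \<open>q\<close> classes: \<open>r - X\<close> occupies
    \<open>n\<close> of them and \<open>U\<close> at least \<open>n\<close>.\<close>
  have cover: "2 * int n - q \<le> int (card {x \<in> X. (r - x) mod q \<in> U})" if r: "r \<in> {0..<q}" for r
  proof -
    let ?V = "(\<lambda>x. (r - x) mod q) ` X"
    have inj: "inj_on (\<lambda>x. (r - x) mod q) X"
    proof (rule inj_onI)
      fix x y assume xy: "x \<in> X" "y \<in> X" "(r - x) mod q = (r - y) mod q"
      then have "q dvd (y - x)" by (simp add: mod_eq_dvd_iff)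
      then have "y = x" by (rule int_window_eqI) (use xy X(1) in auto)
      then show "x = y" ..
    qed
    have "?V \<union> U \<subseteq> {0..<q}" using U(1) q by auto
    then have "card (?V \<union> U) \<le> card {0..<q}" by (intro card_mono) auto
    moreover have "card (?V \<union> U) + card (?V \<inter> U) = card ?V + card U"
      by (rule card_Un_Int[symmetric]) (use fX fU in auto)
    moreover have "card ?V = n" using inj X(2) by (simp add: card_image)
    moreover have "?V \<inter> U = (\<lambda>x. (r - x) mod q) ` {x \<in> X. (r - x) mod q \<in> U}" by auto
    then have "card (?V \<inter> U) \<le> card {x \<in> X. (r - x) mod q \<in> U}"
      by (simp add: card_image_le fX)
    ultimately show ?thesis using U(2) q by simp
  qed
  have "(2 * int n - q) * (\<Sum>r\<in>{0..<q}. F r)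
      \<le> (\<Sum>r\<in>{0..<q}. int (card {x \<in> X. (r - x) mod q \<in> U}) * F r)"
    unfolding sum_distrib_left by (intro sum_mono mult_right_mono cover F)
  also have "\<dots> = (\<Sum>r\<in>{0..<q}. \<Sum>x\<in>X. of_bool ((r - x) mod q \<in> U) * F r)"
    using fX by (simp add: sum_distrib_right[symmetric] sum_of_bool_eq Int_def)
  also have "\<dots> = (\<Sum>x\<in>X. \<Sum>r\<in>{0..<q}. of_bool ((r - x) mod q \<in> U) * F r)"
    by (rule sum.swap)
  also have "\<dots> = (\<Sum>x\<in>X. \<Sum>u\<in>U. F ((u + x) mod q))"
  proof (rule sum.cong[OF refl])
    fix x
    have "(\<Sum>r\<in>{0..<q}. of_bool ((r - x) mod q \<in> U) * F r)
       = (\<Sum>r\<in>{0..<q}. of_bool (((r + x) mod q - x) mod q \<in> U) * F ((r + x) mod q))"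
      by (rule sum_add_mod[OF q, symmetric])
    also have "\<dots> = (\<Sum>r\<in>{0..<q}. if r \<in> U then F ((r + x) mod q) else 0)"
      by (rule sum.cong) (auto simp: mod_simps)
    also have "\<dots> = (\<Sum>u\<in>U. F ((u + x) mod q))"
      using U(1) by (simp add: sum.If_cases Int_absorb1)
    finally show "(\<Sum>r\<in>{0..<q}. of_bool ((r - x) mod q \<in> U) * F r)
      = (\<Sum>u\<in>U. F ((u + x) mod q))" .
  qed
  also have "\<dots> = (\<Sum>u\<in>U. \<Sum>x\<in>X. F ((u + x) mod q))"
    by (rule sum.swap)
  also have "\<dots> \<le> int (card X) * ((\<Sum>u\<in>U. F u) + int (card U) + q + \<tau>)"
    by (rule spread_sum[where X = X, OF q ex]) (use U(1) X(1) in auto)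
  also have "\<dots> \<le> int n * (7 * int k * q + q + q + q)"
  proof (rule mult_mono)
    have "7 * int k * int (card U) \<le> 7 * int k * q" using cUq by (intro mult_left_mono) auto
    then show "(\<Sum>u\<in>U. F u) + int (card U) + q + \<tau> \<le> 7 * int k * q + q + q + q"
      using U(3) cUq \<tau> by linarith
    show "0 \<le> (\<Sum>u\<in>U. F u) + int (card U) + q + \<tau>"
      using F \<tau> q by (simp add: sum_nonneg)
  qed (use X in auto)
  also have "\<dots> = int n * (q * (7 * int k + 3))" by (simp add: algebra_simps)
  finally have *: "(2 * int n - q) * (\<Sum>r\<in>{0..<q}. F r) \<le> int n * (q * (7 * int k + 3))" .
  \<comment> \<open>The hypothesis \<open>2 * q \<le> 3 * n\<close> is equivalent to
    \<open>n \<le> 2 * (2 * n - q)\<close>.\<close>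
  have "int n * (\<Sum>r\<in>{0..<q}. F r) \<le> (2 * (2 * int n - q)) * (\<Sum>r\<in>{0..<q}. F r)"
    by (rule mult_right_mono) (use qn F in \<open>auto simp: sum_nonneg\<close>)
  also have "\<dots> \<le> int n * (2 * q * (7 * int k + 3))"
    using * by (simp add: algebra_simps)
  finally show ?thesis using n0 by simp
qed

subsection \<open>Integer sets with few exits\<close>

lemma card_exits_uminus:
  fixes A :: "int set"
  assumes "finite A"
  shows "card {a \<in> A. a - x \<notin> A} = card {a \<in> A. a + x \<notin> A}"
proof -
  have "bij_betw (\<lambda>a. a + x) (A - {a \<in> A. a + x \<notin> A}) (A - {a \<in> A. a - x \<notin> A})"
    by (rule bij_betw_byWitness[where f' = "\<lambda>a. a - x"]) auto
  then have "card (A - {a \<in> A. a - x \<notin> A}) = card (A - {a \<in> A. a + x \<notin> A})"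
    by (simp add: bij_betw_same_card)
  moreover have "card (A - {a \<in> A. a - x \<notin> A}) = card A - card {a \<in> A. a - x \<notin> A}"
    "card (A - {a \<in> A. a + x \<notin> A}) = card A - card {a \<in> A. a + x \<notin> A}"
    using assms by (auto intro!: card_Diff_subset)
  moreover have "card {a \<in> A. a - x \<notin> A} \<le> card A" "card {a \<in> A. a + x \<notin> A} \<le> card A"
    using assms by (auto intro!: card_mono)
  ultimately show ?thesis by linarith
qed

text \<open>\<open>spread_bound\<close> applies to \<open>upper_class A q\<close>, which vanishes on
  \<open>U\<close>. The excess for \<open>x\<close> is at most
  \<open>n - card (A \<inter> {0..<x})\<close>. Since \<open>{x..<q}\<close> has
  \<open>q - x\<close> points, the set \<open>A \<inter> {0..<x}\<close> has at least
  \<open>x - \<tau>\<close> elements, and \<open>n \<le> q\<close> gives the required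
  \<open>q - x + \<tau>\<close>.\<close>

lemma card_nonneg_part_le:
  fixes A X :: "int set" and q :: int
  assumes A: "finite A" and q: "q > 0"
    and X: "X \<subseteq> {1..q}" "card X = n"
    and \<Delta>: "\<And>x. x \<in> X \<Longrightarrow> card {a \<in> A. a + x \<notin> A} < n"
    and qn: "2 * q \<le> 3 * int n" and k: "n \<le> 3 ^ k"
  defines "U \<equiv> {r \<in> {0..<q}. \<forall>a\<in>A. a mod q = r \<longrightarrow> a < 0}"
  assumes U: "q - int (card (A \<inter> {0..<q})) \<le> 2 * int (card U)" "q - int n < int (card U)"
  shows "int (card {a \<in> A. 0 \<le> a}) \<le> 2 * q * (7 * int k + 3)"
proof -
  define \<tau> where "\<tau> = q - int (card (A \<inter> {0..<q}))"
  have nq: "int n \<le> q"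
    using card_mono[OF _ X(1)] X q by simp
  have ex: "(\<Sum>r\<in>{0..<q}. max 0 (upper_class A q ((r + x) mod q) - upper_class A q r - 1))
      \<le> q - x + \<tau>" if x: "x \<in> X" for x
  proof -
    have x1: "0 < x" "x \<le> q" using x X by auto
    have "card {a \<in> A. 0 \<le> a \<and> a + x \<notin> A} \<le> card {a \<in> A. a + x \<notin> A}"
      using A by (intro card_mono) auto
    then have "card {a \<in> A. 0 \<le> a \<and> a + x \<notin> A} < n" using \<Delta>[OF x] by simp
    moreover have "card (A \<inter> {0..<q}) \<le> card (A \<inter> {0..<x}) + card {x..<q}"
    proof -
      have "A \<inter> {0..<q} \<subseteq> (A \<inter> {0..<x}) \<union> {x..<q}" by auto
      then have "card (A \<inter> {0..<q}) \<le> card ((A \<inter> {0..<x}) \<union> {x..<q})"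
        using A by (intro card_mono) auto
      also have "\<dots> \<le> card (A \<inter> {0..<x}) + card {x..<q}" by (rule card_Un_le)
      finally show ?thesis .
    qed
    ultimately show ?thesis
      using upper_class_excess[OF A x1] x1 nq unfolding \<tau>_def by simp
  qed
  have U0: "upper_class A q u = 0" if "u \<in> U" for u
    using that A by (auto simp: upper_class_def U_def)
  have "card (A \<inter> {0..<q}) \<le> card {0..<q}" by (intro card_mono) auto
  then have \<tau>: "0 \<le> \<tau>" "\<tau> \<le> q" using q by (auto simp: \<tau>_def)
  have "U \<noteq> {}" using U(2) nq by auto
  have "(\<Sum>r\<in>{0..<q}. upper_class A q r) \<le> 2 * q * (7 * int k + 3)"
    by (rule spread_bound[OF q X ex upper_class_nonneg _ \<open>U \<noteq> {}\<close> U0 _ _ \<tau> qn k])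
      (use U in \<open>auto simp: U_def \<tau>_def\<close>)
  then show ?thesis by (simp add: sum_upper_class A q)
qed

text \<open>Each nonempty residue class has an exit at its top, and a class that has elements on both
  sides of the window but misses the window itself has a second one.\<close>

lemma card_one_sided_classes:
  fixes A :: "int set" and q :: int
  assumes A: "finite A" and q: "q > 0" and \<Delta>: "card {a \<in> A. a + q \<notin> A} < n"
  defines "U \<equiv> {r \<in> {0..<q}. \<forall>a\<in>A. a mod q = r \<longrightarrow> a < 0}"
    and "V \<equiv> {r \<in> {0..<q}. \<forall>a\<in>A. a mod q = r \<longrightarrow> q \<le> a}"
  shows "q - int (card (A \<inter> {0..<q})) + q - int n < int (card U) + int (card V)"
    "q - int n < int (card U)" "q - int n < int (card V)"
proof -
  define N where "N = {r \<in> {0..<q}. \<exists>a\<in>A. a mod q = r}"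
  define S where "S = {r \<in> {0..<q}. r \<notin> A \<and> (\<exists>a\<in>A. a mod q = r \<and> a < 0) \<and> (\<exists>a\<in>A. a mod q = r \<and> q \<le> a)}"
  define g where "g r = Max {a \<in> A. a mod q = r}" for r
  define h where "h r = Max {a \<in> A. a mod q = r \<and> a < 0}" for r
  have g: "g r \<in> A" "g r mod q = r" "\<And>a. a \<in> A \<Longrightarrow> a mod q = r \<Longrightarrow> a \<le> g r" if "r \<in> N" for r
  proof -
    have "g r \<in> {a \<in> A. a mod q = r}"
      unfolding g_def by (rule Max_in) (use A that in \<open>auto simp: N_def\<close>)
    then show "g r \<in> A" "g r mod q = r" by auto
    show "a \<le> g r" if "a \<in> A" "a mod q = r" for a
      unfolding g_def by (rule Max_ge) (use A that in auto)
  qed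
  have h: "h r \<in> A" "h r mod q = r" "h r < 0"
    "\<And>a. a \<in> A \<Longrightarrow> a mod q = r \<Longrightarrow> a < 0 \<Longrightarrow> a \<le> h r" if "r \<in> S" for r
  proof -
    have "h r \<in> {a \<in> A. a mod q = r \<and> a < 0}"
      unfolding h_def by (rule Max_in) (use A that in \<open>auto simp: S_def\<close>)
    then show "h r \<in> A" "h r mod q = r" "h r < 0" by auto
    show "a \<le> h r" if "a \<in> A" "a mod q = r" "a < 0" for a
      unfolding h_def by (rule Max_ge) (use A that in auto)
  qed
  have gE: "g ` N \<subseteq> {a \<in> A. a + q \<notin> A}"
  proof
    fix b assume "b \<in> g ` N"
    then obtain r where r: "r \<in> N" "b = g r" by blast
    have "g r + q \<notin> A" using g(3)[OF r(1), of "g r + q"] g(2)[OF r(1)] q by auto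
    then show "b \<in> {a \<in> A. a + q \<notin> A}" using r g(1) by auto
  qed
  have hE: "h ` S \<subseteq> {a \<in> A. a + q \<notin> A}"
  proof
    fix b assume "b \<in> h ` S"
    then obtain r where r: "r \<in> S" "b = h r" by blast
    have "h r + q \<notin> A"
    proof
      assume *: "h r + q \<in> A"
      then have "\<not> h r + q < 0" using h(4)[OF r(1), of "h r + q"] h(2)[OF r(1)] q by auto
      then have "h r + q \<in> {0..<q}" using h(3)[OF r(1)] by auto
      then have "(h r + q) mod q = h r + q" by (intro mod_pos_pos_trivial) auto
      then have "h r + q = r" using h(2)[OF r(1)] by simp
      then show False using * r(1) by (simp add: S_def)
    qed
    then show "b \<in> {a \<in> A. a + q \<notin> A}" using r h(1) by auto
  qed
  have gh: "g ` N \<inter> h ` S = {}"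
  proof (rule ccontr)
    assume "g ` N \<inter> h ` S \<noteq> {}"
    then obtain r s where rs: "r \<in> N" "s \<in> S" "g r = h s" by auto
    then have "r = s" using g(2)[OF rs(1)] h(2)[OF rs(2)] by simp
    obtain a where "a \<in> A" "a mod q = s" "q \<le> a" using rs(2) by (auto simp: S_def)
    then show False using g(3)[OF rs(1), of a] rs(3) h(3)[OF rs(2)] \<open>r = s\<close> q by simp
  qed
  have fin: "finite N" "finite S" "finite U" "finite V"
    by (rule finite_subset[of _ "{0..<q}"]; auto simp: N_def S_def U_def V_def)+
  have "inj_on g N" by (metis g(2) inj_onI)
  moreover have "inj_on h S" by (metis h(2) inj_onI)
  ultimately have "card N + card S = card (g ` N \<union> h ` S)"
    using gh fin by (simp add: card_Un_disjoint card_image)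
  also have "\<dots> \<le> card {a \<in> A. a + q \<notin> A}"
    by (rule card_mono) (use A gE hE in auto)
  finally have NS: "card N + card S < n" using \<Delta> by simp
  have cN: "int (card ({0..<q} - N)) = q - int (card N)"
  proof -
    have "N \<subseteq> {0..<q}" by (auto simp: N_def)
    moreover from this have "card N \<le> card {0..<q}" by (intro card_mono) auto
    ultimately show ?thesis using q fin by (simp add: card_Diff_subset of_nat_diff)
  qed
  \<comment> \<open>Empty classes satisfy both conditions vacuously. Being counted in
    \<open>U\<close> and in \<open>V\<close>, they contribute the additional \<open>q - n\<close> in
    the first conclusion.\<close>
  have sub: "{0..<q} - N \<subseteq> U \<inter> V" by (auto simp: N_def U_def V_def)
  then have "card ({0..<q} - N) \<le> card U" "card ({0..<q} - N) \<le> card V"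
    "card ({0..<q} - N) \<le> card (U \<inter> V)"
    using fin by (auto intro!: card_mono)
  then show "q - int n < int (card U)" "q - int n < int (card V)" using cN NS by linarith+
  have "{0..<q} - A \<subseteq> (U \<union> V) \<union> S"
  proof
    fix r assume r: "r \<in> {0..<q} - A"
    have "a < 0 \<or> q \<le> a" if "a \<in> A" "a mod q = r" for a
    proof (rule ccontr)
      assume "\<not> (a < 0 \<or> q \<le> a)"
      then have "a mod q = a" by (intro mod_pos_pos_trivial) auto
      then show False using that r by simp
    qed
    then show "r \<in> (U \<union> V) \<union> S" using r unfolding U_def V_def S_def by force
  qed
  then have "card ({0..<q} - A) \<le> card ((U \<union> V) \<union> S)" using fin by (intro card_mono) auto
  also have "\<dots> \<le> card (U \<union> V) + card S" by (rule card_Un_le)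
  finally have "card ({0..<q} - A) \<le> card (U \<union> V) + card S" .
  moreover have "card (A \<inter> {0..<q}) + card ({0..<q} - A) = nat q"
  proof -
    have "card ((A \<inter> {0..<q}) \<union> ({0..<q} - A)) = card (A \<inter> {0..<q}) + card ({0..<q} - A)"
      by (rule card_Un_disjoint) auto
    moreover have "(A \<inter> {0..<q}) \<union> ({0..<q} - A) = {0..<q}" by auto
    ultimately show ?thesis by simp
  qed
  moreover have "card (U \<union> V) + card (U \<inter> V) = card U + card V"
    by (rule card_Un_Int[symmetric]) (use fin in auto)
  ultimately show "q - int (card (A \<inter> {0..<q})) + q - int n < int (card U) + int (card V)"
    using \<open>card ({0..<q} - N) \<le> card (U \<inter> V)\<close> cN NS q by linarith
qed

text \<open>Take the largest \<open>w\<close> in \<open>A\<close> with at least half of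
  \<open>A\<close> at or above it. The next element of \<open>A\<close>, if any, has less than half
  of \<open>A\<close> at or above it, so at least half lies at or below \<open>w\<close>.\<close>

lemma exists_median:
  fixes A :: "int set"
  assumes A: "finite A" "A \<noteq> {}"
  shows "\<exists>w. card A \<le> 2 * card {a \<in> A. w \<le> a} \<and> card A \<le> 2 * card {a \<in> A. a \<le> w}"
proof -
  define M where "M = {w \<in> A. card A \<le> 2 * card {a \<in> A. w \<le> a}}"
  have "{a \<in> A. Min A \<le> a} = A" using A by auto
  then have "Min A \<in> M" using A unfolding M_def by simp
  then have M: "finite M" "M \<noteq> {}" using A(1) unfolding M_def by (simp, blast)
  define w where "w = Max M"
  have w: "w \<in> A" "card A \<le> 2 * card {a \<in> A. w \<le> a}"
    using Max_in[OF M] by (auto simp: M_def w_def)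
  have "2 * card {a \<in> A. w < a} \<le> card A"
  proof (cases "{a \<in> A. w < a} = {}")
    case False
    define v where "v = Min {a \<in> A. w < a}"
    have "v \<in> {a \<in> A. w < a}" unfolding v_def using A False by (intro Min_in) auto
    then have v: "v \<in> A" "w < v" by auto
    have "{a \<in> A. w < a} = {a \<in> A. v \<le> a}"
      using v A by (auto simp: v_def intro!: Min_le)
    moreover have "v \<notin> M" using v(2) Max_ge[OF M(1), of v] by (auto simp: w_def)
    ultimately show ?thesis using v(1) by (auto simp: M_def)
  next
    case True
    show ?thesis unfolding True by simp
  qed
  moreover have "card A = card {a \<in> A. w < a} + card {a \<in> A. a \<le> w}"
  proof -
    have "card ({a \<in> A. w < a} \<union> {a \<in> A. a \<le> w}) = card {a \<in> A. w < a} + card {a \<in> A. a \<le> w}"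
      by (rule card_Un_disjoint) (use A in auto)
    moreover have "{a \<in> A. w < a} \<union> {a \<in> A. a \<le> w} = A" by auto
    ultimately show ?thesis by simp
  qed
  ultimately show ?thesis using w by (intro exI[of _ w]) auto
qed

lemma card_image_conj:
  assumes "inj f"
  shows "card {b \<in> f ` A. P b} = card {a \<in> A. P (f a)}"
proof -
  have "{b \<in> f ` A. P b} = f ` {a \<in> A. P (f a)}" by auto
  then show ?thesis using assms by (simp add: card_image inj_on_subset)
qed

text \<open>Put the median at \<open>0\<close>. The shift \<open>q\<close> belongs to
  \<open>X\<close>, so \<open>card_one_sided_classes\<close> makes one of \<open>U\<close>,
  \<open>V\<close> at least half as large as the number of points missing from the window. A large
  \<open>U\<close> bounds the part above the median, a large \<open>V\<close> the part below the end
  of the window; either contains half of \<open>A\<close>.\<close>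

theorem int_few_exits_bound:
  fixes A X :: "int set" and q :: int
  assumes A: "finite A"
    and X: "X \<subseteq> {1..q}" "card X = n" "q \<in> X"
    and \<Delta>: "\<And>x. x \<in> X \<Longrightarrow> card {a \<in> A. a + x \<notin> A} < n"
    and qn: "2 * q \<le> 3 * int n" and k: "n \<le> 3 ^ k"
  shows "int (card A) \<le> 4 * q * (7 * int k + 3)"
proof (cases "A = {}")
  case False
  have q: "q > 0" using X by auto
  obtain w where w: "card A \<le> 2 * card {a \<in> A. w \<le> a}" "card A \<le> 2 * card {a \<in> A. a \<le> w}"
    using exists_median[OF A False] by blast
  define B where "B = (\<lambda>a. a - w) ` A"
  have B: "finite B" using A by (simp add: B_def)
  have inj: "inj (\<lambda>a. a - w)" by (simp add: inj_on_def)
  have mem: "z \<in> B \<longleftrightarrow> z + w \<in> A" for z by (force simp: B_def)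
  have \<Delta>B: "card {b \<in> B. b + x \<notin> B} < n" if "x \<in> X" for x
    using \<Delta>[OF that] card_image_conj[OF inj, of A "\<lambda>b. b + x \<notin> B"]
    by (simp add: mem B_def[symmetric] algebra_simps)
  define U where "U = {r \<in> {0..<q}. \<forall>a\<in>B. a mod q = r \<longrightarrow> a < 0}"
  define V where "V = {r \<in> {0..<q}. \<forall>a\<in>B. a mod q = r \<longrightarrow> q \<le> a}"
  have UV: "q - int (card (B \<inter> {0..<q})) + q - int n < int (card U) + int (card V)"
    "q - int n < int (card U)" "q - int n < int (card V)"
    unfolding U_def V_def by (rule card_one_sided_classes[OF B q \<Delta>B[OF X(3)]])+
  have nq: "int n \<le> q"
    using card_mono[OF _ X(1)] X(2) q by simp
  consider "q - int (card (B \<inter> {0..<q})) \<le> 2 * int (card U)"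
    | "q - int (card (B \<inter> {0..<q})) \<le> 2 * int (card V)"
    using UV nq by linarith
  then show ?thesis
  proof cases
    case 1
    have "int (card {a \<in> B. 0 \<le> a}) \<le> 2 * q * (7 * int k + 3)"
      by (rule card_nonneg_part_le[OF B q X(1,2) \<Delta>B qn k]) (use 1 UV in \<open>auto simp: U_def\<close>)
    moreover have "card {a \<in> B. 0 \<le> a} = card {a \<in> A. w \<le> a}"
      unfolding B_def by (simp add: card_image_conj[OF inj])
    ultimately show ?thesis using w by linarith
  next
    case 2
    \<comment> \<open>This reflection preserves the window \<open>{0..<q}\<close>, carries
      \<open>V\<close> to the set playing the role of \<open>U\<close>, and turns the shift
      \<open>x\<close> into \<open>- x\<close>, which has the same number of exits.\<close>
    define C where "C = (\<lambda>b. q - 1 - b) ` B"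
    have C: "finite C" using B by (simp add: C_def)
    have inj2: "inj (\<lambda>b. q - 1 - b)" by (simp add: inj_on_def)
    have memC: "z \<in> C \<longleftrightarrow> q - 1 - z \<in> B" for z by (force simp: C_def)
    have \<Delta>C: "card {c \<in> C. c + x \<notin> C} < n" if "x \<in> X" for x
    proof -
      have "card {c \<in> C. c + x \<notin> C} = card {b \<in> B. q - 1 - b + x \<notin> C}"
        by (subst (1) C_def) (rule card_image_conj[OF inj2])
      also have "{b \<in> B. q - 1 - b + x \<notin> C} = {b \<in> B. b - x \<notin> B}"
        by (simp add: memC algebra_simps)
      finally show ?thesis using \<Delta>B[OF that] card_exits_uminus[OF B, of x] by simp
    qed
    have eqV: "{r \<in> {0..<q}. \<forall>a\<in>C. a mod q = r \<longrightarrow> a < 0} = (\<lambda>b. q - 1 - b) ` V"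
    proof -
      have *: "(\<forall>a\<in>C. a mod q = r \<longrightarrow> a < 0) \<longleftrightarrow> (\<forall>b\<in>B. b mod q = q - 1 - r \<longrightarrow> q \<le> b)"
        if r: "r \<in> {0..<q}" for r
      proof -
        have "(q - 1 - b) mod q = r \<longleftrightarrow> b mod q = q - 1 - r" for b
        proof -
          have "(q - 1 - b) mod q = r \<longleftrightarrow> q dvd (q - 1 - b - r)"
            using r mod_pos_pos_trivial[of r q] by (metis atLeastLessThan_iff mod_eq_dvd_iff)
          also have "\<dots> \<longleftrightarrow> q dvd (b - (q - 1 - r))"
            by (subst dvd_minus_iff[symmetric]) (simp add: algebra_simps)
          also have "\<dots> \<longleftrightarrow> b mod q = (q - 1 - r) mod q" by (simp add: mod_eq_dvd_iff)
          also have "(q - 1 - r) mod q = q - 1 - r" using r by simp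
          finally show ?thesis .
        qed
        then show ?thesis by (auto simp: C_def)
      qed
      show ?thesis
      proof (rule Set.set_eqI)
        fix r
        have "r \<in> {r \<in> {0..<q}. \<forall>a\<in>C. a mod q = r \<longrightarrow> a < 0} \<longleftrightarrow> q - 1 - r \<in> V"
        proof (cases "r \<in> {0..<q}")
          case True
          then show ?thesis using *[OF True] by (simp add: V_def)
        next
          case False
          then show ?thesis by (auto simp: V_def)
        qed
        also have "\<dots> \<longleftrightarrow> r \<in> (\<lambda>b. q - 1 - b) ` V" by force
        finally show "r \<in> {r \<in> {0..<q}. \<forall>a\<in>C. a mod q = r \<longrightarrow> a < 0} \<longleftrightarrow> r \<in> (\<lambda>b. q - 1 - b) ` V" .
      qed
    qed
    have cV: "card {r \<in> {0..<q}. \<forall>a\<in>C. a mod q = r \<longrightarrow> a < 0} = card V"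
      unfolding eqV using inj2 by (simp add: card_image inj_on_subset)
    have cW: "card (C \<inter> {0..<q}) = card (B \<inter> {0..<q})"
    proof -
      have "C \<inter> {0..<q} = (\<lambda>b. q - 1 - b) ` (B \<inter> {0..<q})" by (auto simp: C_def image_iff)
      then show ?thesis using inj2 by (simp add: card_image inj_on_subset)
    qed
    have "int (card {a \<in> C. 0 \<le> a}) \<le> 2 * q * (7 * int k + 3)"
      by (rule card_nonneg_part_le[OF C q X(1,2) \<Delta>C qn k]) (unfold cV cW, use 2 UV in auto)
    moreover have "card {a \<in> C. 0 \<le> a} = card {b \<in> B. b < q}"
      unfolding C_def by (simp add: card_image_conj[OF inj2] zle_diff1_eq)
    moreover have "card {b \<in> B. b < q} = card {a \<in> A. a < w + q}"
      unfolding B_def by (simp add: card_image_conj[OF inj] algebra_simps)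
    moreover have "card {a \<in> A. a \<le> w} \<le> card {a \<in> A. a < w + q}"
      using A q by (intro card_mono) auto
    ultimately show ?thesis using w by linarith
  qed
next
  case True
  have "0 < q" using X by auto
  then show ?thesis using True by simp
qed

subsection \<open>Symmetric sets with small doubling\<close>

text \<open>Residues are kept as integers in \<open>{0..<M}\<close>, so that the same notion serves
  for the modulus \<open>Max E\<close> and for the prime.\<close>

definition mod_sumset :: "int \<Rightarrow> int set \<Rightarrow> int set \<Rightarrow> int set" where
  "mod_sumset M X Y = (\<lambda>(x, y). (x + y) mod M) ` (X \<times> Y)"

lemma mod_sumsetI: "x \<in> X \<Longrightarrow> y \<in> Y \<Longrightarrow> (x + y) mod M \<in> mod_sumset M X Y"
  by (auto simp: mod_sumset_def)

lemma mod_sumsetE: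
  assumes "z \<in> mod_sumset M X Y"
  obtains x y where "x \<in> X" "y \<in> Y" "z = (x + y) mod M"
  using assms by (auto simp: mod_sumset_def)

lemma mod_sumset_subset: "M > 0 \<Longrightarrow> mod_sumset M X Y \<subseteq> {0..<M}"
  by (auto simp: mod_sumset_def)

lemma card_image_add_mod:
  fixes M c :: int
  assumes "M > 0" "Y \<subseteq> {0..<M}"
  shows "card ((\<lambda>y. (y + c) mod M) ` Y) = card Y"
  by (rule card_image)
    (rule inj_on_subset[OF bij_betw_imp_inj_on[OF bij_betw_add_mod[OF assms(1)]] assms(2)])

text \<open>For \<open>z = a + b\<close> in \<open>H\<close>, both \<open>Y + a\<close> and
  \<open>Y - b\<close> lie in \<open>H\<close>, so they share more than half of
  \<open>card Y\<close> elements; each gives a \<open>y\<close> in \<open>Y\<close> with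
  \<open>y + z\<close> in \<open>Y\<close>. Applied to \<open>- g\<close> and \<open>h\<close>, this
  yields a common \<open>y\<close>, and \<open>g + h = (y + h) - (y - g)\<close> lies in
  \<open>Y - Y = Y + Y\<close>.\<close>

lemma mod_sumset_closed:
  fixes M :: int
  assumes M: "M > 0" and Y: "Y \<subseteq> {0..<M}"
    and sym: "\<And>y. y \<in> Y \<Longrightarrow> (- y) mod M \<in> Y"
  defines "H \<equiv> mod_sumset M Y Y"
  assumes small: "2 * card H < 3 * card Y"
    and gh: "g \<in> H" "h \<in> H"
  shows "(g + h) mod M \<in> H"
proof -
  have fY: "finite Y" using Y finite_subset by blast
  have fH: "finite H" using fY by (simp add: H_def mod_sumset_def)
  define N where "N z = {y \<in> Y. (y + z) mod M \<in> Y}" for z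
  have big: "card Y < 2 * card (N z)" if z: "z \<in> H" for z
  proof -
    obtain a b where ab: "a \<in> Y" "b \<in> Y" "z = (a + b) mod M"
      using z unfolding H_def by (rule mod_sumsetE)
    let ?S = "(\<lambda>y. (y + a) mod M) ` Y" and ?T = "(\<lambda>y. (y + (- b)) mod M) ` Y"
    have "?S \<subseteq> H" using ab(1) by (auto simp: H_def intro: mod_sumsetI)
    moreover have "?T \<subseteq> H"
    proof
      fix w assume "w \<in> ?T"
      then obtain y where "y \<in> Y" "w = (y + (- b) mod M) mod M" by (auto simp: mod_simps)
      then show "w \<in> H" using sym[OF ab(2)] by (simp only: H_def mod_sumsetI)
    qed
    ultimately have "card (?S \<union> ?T) \<le> card H" using fH by (intro card_mono) auto
    moreover have "card (?S \<union> ?T) + card (?S \<inter> ?T) = card ?S + card ?T"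
      by (rule card_Un_Int[symmetric]) (use fY in auto)
    moreover have "card ?S = card Y" "card ?T = card Y"
      by (rule card_image_add_mod[OF M Y])+
    moreover have "?S \<inter> ?T \<subseteq> (\<lambda>y. (y + a) mod M) ` N z"
    proof
      fix w assume "w \<in> ?S \<inter> ?T"
      then obtain y y' where y: "y \<in> Y" "y' \<in> Y" "w = (y + a) mod M" "w = (y' + - b) mod M" by auto
      have "(y + z) mod M = ((y + a) mod M + b) mod M"
        by (simp add: ab(3) mod_simps add.assoc)
      also have "\<dots> = ((y' + - b) mod M + b) mod M" using y(3,4) by simp
      also have "\<dots> = y'" using y(2) Y by (simp add: mod_simps subset_iff)
      finally have "y \<in> N z" using y(1,2) by (simp add: N_def)
      then show "w \<in> (\<lambda>y. (y + a) mod M) ` N z" using y(3) by blast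
    qed
    then have "card (?S \<inter> ?T) \<le> card (N z)"
      using fY by (intro order.trans[OF card_mono card_image_le]) (auto simp: N_def)
    ultimately show ?thesis using small by linarith
  qed
  have ng: "(- g) mod M \<in> H"
  proof -
    obtain a b where ab: "a \<in> Y" "b \<in> Y" "g = (a + b) mod M"
      using gh(1) unfolding H_def by (rule mod_sumsetE)
    have "(- g) mod M = ((- a) mod M + (- b) mod M) mod M"
      by (simp add: ab(3) mod_simps)
    then show ?thesis using sym ab(1,2) by (simp only: H_def mod_sumsetI)
  qed
  have "N ((- g) mod M) \<inter> N h \<noteq> {}"
  proof
    assume "N ((- g) mod M) \<inter> N h = {}"
    then have "card (N ((- g) mod M) \<union> N h) = card (N ((- g) mod M)) + card (N h)"
      using fY by (intro card_Un_disjoint) (auto simp: N_def)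
    moreover have "card (N ((- g) mod M) \<union> N h) \<le> card Y"
      using fY by (intro card_mono) (auto simp: N_def)
    ultimately show False using big[OF ng] big[OF gh(2)] by linarith
  qed
  then obtain y where y: "(y + (- g) mod M) mod M \<in> Y" "(y + h) mod M \<in> Y"
    by (auto simp: N_def)
  have "((y + h) mod M + (- ((y + (- g) mod M) mod M)) mod M) mod M = (g + h) mod M"
    by (simp add: mod_simps add.commute)
  then show ?thesis using y sym unfolding H_def by (metis mod_sumsetI)
qed

text \<open>The least positive element divides all others by division with remainder;
  \<open>M\<close> ensures that a positive element exists.\<close>

lemma int_subgroup_generator:
  fixes H :: "int set"
  assumes add: "\<And>x y. x \<in> H \<Longrightarrow> y \<in> H \<Longrightarrow> x + y \<in> H"
    and neg: "\<And>x. x \<in> H \<Longrightarrow> - x \<in> H" and M: "M \<in> H" "M > 0"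
  shows "\<exists>d>0. d \<in> H \<and> (\<forall>x\<in>H. d dvd x)"
proof -
  define k where "k = (LEAST k. k > 0 \<and> int k \<in> H)"
  have ex: "nat M > 0 \<and> int (nat M) \<in> H" using M by simp
  have k: "k > 0" "int k \<in> H" using LeastI[of "\<lambda>k. k > 0 \<and> int k \<in> H", OF ex] by (auto simp: k_def)
  have min: "k \<le> j" if "j > 0" "int j \<in> H" for j
    unfolding k_def by (rule Least_le) (use that in auto)
  have zero: "0 \<in> H" using add[OF M(1) neg[OF M(1)]] by simp
  have nat_mult: "int k * int j \<in> H" for j
  proof (induction j)
    case (Suc j)
    show ?case using add[OF k(2) Suc.IH] by (simp add: algebra_simps)
  qed (simp add: zero)
  have mult: "int k * j \<in> H" for j
    using nat_mult[of "nat j"] neg[OF nat_mult[of "nat (- j)"]] by (cases "j \<ge> 0") auto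
  have "int k dvd x" if x: "x \<in> H" for x
  proof -
    have "x + - (int k * (x div int k)) \<in> H" by (intro add neg mult x)
    then have "x mod int k \<in> H" by (simp add: minus_mult_div_eq_mod)
    moreover have "0 \<le> x mod int k" "x mod int k < int k" using k by auto
    ultimately have "x mod int k = 0" using min[of "nat (x mod int k)"] by force
    then show ?thesis by auto
  qed
  then show ?thesis using k by (intro exI[of _ "int k"]) auto
qed

text \<open>The points \<open>Max S + M\<close> and \<open>Min S - M\<close> are new and
  distinct.\<close>

lemma card_Un_shifts_ge:
  fixes S :: "int set"
  assumes "finite S" "S \<noteq> {}" "M > 0"
  shows "card S + 2 \<le> card (S \<union> (\<lambda>s. s + M) ` S \<union> (\<lambda>s. s - M) ` S)"
proof -
  have "Max S + M \<notin> S"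
  proof
    assume "Max S + M \<in> S"
    with assms(1) have "Max S + M \<le> Max S" by (rule Max_ge)
    then show False using assms(3) by simp
  qed
  moreover have "Min S - M \<notin> S"
  proof
    assume "Min S - M \<in> S"
    with assms(1) have "Min S \<le> Min S - M" by (rule Min_le)
    then show False using assms(3) by simp
  qed
  moreover have "Min S \<le> Max S" using assms by simp
  then have "Max S + M \<noteq> Min S - M" using assms(3) by linarith
  ultimately have "card (insert (Max S + M) (insert (Min S - M) S)) = card S + 2"
    using assms by simp
  moreover have "card (insert (Max S + M) (insert (Min S - M) S))
      \<le> card (S \<union> (\<lambda>s. s + M) ` S \<union> (\<lambda>s. s - M) ` S)"
    using assms by (intro card_mono) auto
  ultimately show ?thesis by simp
qed

text \<open>Reducing modulo the largest element \<open>M\<close> of \<open>E\<close> costs at least two sums per class, because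
  \<open>E\<close> contains \<open>-M\<close>, \<open>0\<close> and \<open>M\<close>; hence the reduction of \<open>E\<close> has so small a sumset modulo
  \<open>M\<close> that this sumset is a subgroup.\<close>

lemma symmetric_small_doubling:
  fixes E :: "int set" and k s :: int
  assumes E: "finite E" "0 \<in> E" and sym: "\<And>e. e \<in> E \<Longrightarrow> - e \<in> E"
    and k: "int (card E) = 2 * k + 1" "k > 0"
    and s: "int (card ((\<lambda>(a, b). a + b) ` (E \<times> E))) = s" "2 * s < 9 * k + 2"
  shows "\<exists>d l. d > 0 \<and> l \<le> s - 3 * k - 1 \<and> (\<exists>e\<in>E. d \<le> e) \<and> (\<forall>e\<in>E. d dvd e \<and> \<bar>e\<bar> \<le> d * l)"
proof -
  define M where "M = Max E"
  define SS where "SS = (\<lambda>(a, b). a + b) ` (E \<times> E)"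
  have fS: "finite SS" using E by (simp add: SS_def)
  have ME: "M \<in> E" "\<And>e. e \<in> E \<Longrightarrow> e \<le> M" unfolding M_def using E by (blast intro: Max_in, simp)
  have bound: "\<bar>e\<bar> \<le> M" if "e \<in> E" for e using ME(2)[OF that] ME(2)[OF sym[OF that]] by simp
  have M: "M > 0"
  proof (rule ccontr)
    assume "\<not> M > 0"
    then have "E \<subseteq> {0}" using bound by force
    then have "card E \<le> 1" using card_mono[of "{0::int}" E] by simp
    then show False using k by simp
  qed
  define Y where "Y = (\<lambda>e. e mod M) ` E"
  define H where "H = mod_sumset M Y Y"
  have Y: "Y \<subseteq> {0..<M}" "finite Y" using M E by (auto simp: Y_def)
  have H: "H \<subseteq> {0..<M}" "finite H"
    using mod_sumset_subset[OF M, of Y Y] Y by (auto simp: H_def mod_sumset_def)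
  have Y0: "0 \<in> Y" using E(2) by (auto simp: Y_def image_iff intro!: bexI[of _ 0])
  have YH: "Y \<subseteq> H"
  proof
    fix y assume y: "y \<in> Y"
    then have "(y + 0) mod M \<in> H" unfolding H_def by (intro mod_sumsetI Y0)
    then show "y \<in> H" using y Y(1) by (auto simp: subset_iff)
  qed
  have symY: "(- y) mod M \<in> Y" if "y \<in> Y" for y
    using that sym by (auto simp: Y_def mod_minus_eq)
  have HI: "(a + b) mod M \<in> H" if "a \<in> E" "b \<in> E" for a b
  proof -
    have "(a mod M + b mod M) mod M \<in> H" unfolding H_def by (rule mod_sumsetI) (use that in \<open>auto simp: Y_def\<close>)
    then show ?thesis by (simp add: mod_simps)
  qed
  define Er where "Er r = {e \<in> E. e mod M = r}" for r
  define Sr where "Sr r = {e \<in> SS. e mod M = r}" for r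
  have cSr: "card (Er r) + of_bool (r \<in> Y) + of_bool (r \<in> H) \<le> card (Sr r)" for r
  proof (cases "r \<in> Y")
    case True
    have ne: "finite (Er r)" "Er r \<noteq> {}" using True E by (auto simp: Er_def Y_def)
    have "card (Er r) + 2 \<le> card (Er r \<union> (\<lambda>s. s + M) ` Er r \<union> (\<lambda>s. s - M) ` Er r)"
      by (rule card_Un_shifts_ge[OF ne M])
    also have "\<dots> \<le> card (Sr r)"
    proof (rule card_mono)
      have "e \<in> SS" "e + M \<in> SS" "e - M \<in> SS" if "e \<in> E" for e
        using that E(2) ME(1) sym[OF ME(1)] unfolding SS_def
        by (force intro: image_eqI[of _ _ "(e, 0)"] image_eqI[of _ _ "(e, M)"] image_eqI[of _ _ "(e, - M)"])+
      then show "Er r \<union> (\<lambda>s. s + M) ` Er r \<union> (\<lambda>s. s - M) ` Er r \<subseteq> Sr r"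
        by (auto simp: Er_def Sr_def)
    qed (use fS in \<open>auto simp: Sr_def\<close>)
    finally show ?thesis using True YH by auto
  next
    case False
    then have "Er r = {}" by (auto simp: Er_def Y_def)
    moreover have "1 \<le> card (Sr r)" if rH: "r \<in> H"
    proof -
      obtain y z where yz: "y \<in> Y" "z \<in> Y" "r = (y + z) mod M"
        using rH unfolding H_def by (rule mod_sumsetE)
      obtain a b where ab: "a \<in> E" "b \<in> E" "y = a mod M" "z = b mod M"
        using yz(1,2) unfolding Y_def by blast
      have "(a + b) mod M = r" by (simp add: yz(3) ab(3,4) mod_simps)
      moreover have "a + b \<in> SS" unfolding SS_def using ab(1,2) by force
      ultimately have "a + b \<in> Sr r" by (simp add: Sr_def)
      then show ?thesis using fS by (auto simp: Sr_def card_gt_0_iff Suc_le_eq)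
    qed
    ultimately show ?thesis using False by (auto simp: of_bool_def)
  qed
  have cE: "card E = (\<Sum>r\<in>{0..<M}. card (Er r))"
    unfolding Er_def by (rule card_eq_sum_mod[OF M E(1)])
  have "card E + card Y + card H = (\<Sum>r\<in>{0..<M}. card (Er r) + of_bool (r \<in> Y) + of_bool (r \<in> H))"
    using Y(1) H(1) by (simp add: sum.distrib cE sum_of_bool_eq Int_absorb1)
  also have "\<dots> \<le> (\<Sum>r\<in>{0..<M}. card (Sr r))" by (intro sum_mono cSr)
  also have "\<dots> = card SS" unfolding Sr_def by (rule card_eq_sum_mod[OF M fS, symmetric])
  finally have cSS: "card E + card Y + card H \<le> card SS" .
  \<comment> \<open>As \<open>E\<close> lies in \<open>{- M..M}\<close>, a residue \<open>r\<close>
    has at most the representatives \<open>r\<close> and \<open>r - M\<close>, and \<open>M\<close>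
    in addition when \<open>r = 0\<close>. Hence
    \<open>2 * k + 1 \<le> 2 * card Y + 1\<close>.\<close>
  have "card E = (\<Sum>r\<in>{0..<M}. card (Er r))" by (rule cE)
  also have "\<dots> \<le> (\<Sum>r\<in>{0..<M}. 2 * of_bool (r \<in> Y) + of_bool (r \<in> {0}))"
  proof (rule sum_mono)
    fix r assume r: "r \<in> {0..<M}"
    have "Er r \<subseteq> {r, r - M} \<union> (if r = 0 then {M} else {})"
    proof
      fix e assume e: "e \<in> Er r"
      then have er: "e mod M = r" "- M \<le> e" "e \<le> M" using bound[of e] by (auto simp: Er_def)
      show "e \<in> {r, r - M} \<union> (if r = 0 then {M} else {})"
      proof (cases "e = M")
        case True
        then show ?thesis using er by auto
      next
        case False
        show ?thesis
        proof (cases "e \<ge> 0")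
          case True
          then have "e mod M = e" using False er by (intro mod_pos_pos_trivial) auto
          then show ?thesis using er by simp
        next
          case neg: False
          then have "(e + M) mod M = e + M" using er by (intro mod_pos_pos_trivial) auto
          then show ?thesis using er by simp
        qed
      qed
    qed
    then have "card (Er r) \<le> card ({r, r - M} \<union> (if r = 0 then {M} else {}))"
      by (intro card_mono) auto
    also have "\<dots> \<le> 2 + of_bool (r \<in> {0})"
      using M by (auto simp: card_insert_if)
    finally have "card (Er r) \<le> 2 + of_bool (r \<in> {0})" .
    moreover have "Er r = {}" if "r \<notin> Y" using that by (auto simp: Er_def Y_def)
    ultimately show "card (Er r) \<le> 2 * of_bool (r \<in> Y) + of_bool (r \<in> {0})" by (cases "r \<in> Y") auto
  qed
  also have "\<dots> = 2 * card Y + 1"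
    using Y(1) M by (simp add: sum.distrib sum_distrib_left[symmetric] sum_of_bool_eq Int_absorb1 del: of_bool_eq_1_iff)
  finally have cY: "k \<le> int (card Y)" using k by simp
  have cH: "int (card H) \<le> s - 3 * k - 1"
    using cSS cY k s by (simp add: SS_def)
  \<comment> \<open>The hypothesis \<open>2 * s < 9 * k + 2\<close> says exactly that
    \<open>2 * (s - 3 * k - 1) < 3 * k\<close>.\<close>
  have small: "2 * card H < 3 * card Y" using cH cY s by linarith
  \<comment> \<open>The preimage of \<open>H\<close> in the integers is a subgroup containing
    \<open>E\<close> and \<open>M\<close>; its generator is the common difference
    \<open>d\<close>.\<close>
  define G where "G = {z. z mod M \<in> H}"
  have "\<exists>d>0. d \<in> G \<and> (\<forall>x\<in>G. d dvd x)"
  proof (rule int_subgroup_generator)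
    show "x + y \<in> G" if "x \<in> G" "y \<in> G" for x y
      using mod_sumset_closed[OF M Y(1) symY, of "x mod M" "y mod M"] small that
      by (simp add: G_def H_def mod_simps)
    show "- x \<in> G" if xG: "x \<in> G" for x
    proof -
      obtain a b where ab: "a \<in> Y" "b \<in> Y" "x mod M = (a + b) mod M"
        using xG unfolding G_def H_def by (auto elim: mod_sumsetE)
      have "(- x) mod M = (- (x mod M)) mod M" by (simp add: mod_simps)
      also have "\<dots> = ((- a) mod M + (- b) mod M) mod M" unfolding ab(3) by (simp add: mod_simps)
      also have "\<dots> \<in> H" unfolding H_def by (intro mod_sumsetI symY ab)
      finally show ?thesis by (simp add: G_def)
    qed
    show "M \<in> G" using Y0 YH by (auto simp: G_def)
  qed (rule M)
  then obtain d where d: "d > 0" "d \<in> G" "\<And>x. x \<in> G \<Longrightarrow> d dvd x" by blast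
  have EG: "e \<in> G" if "e \<in> E" for e using that YH by (auto simp: G_def Y_def)
  have dM: "d dvd M" using d(3) EG ME(1) by blast
  define l where "l = M div d"
  have l: "d * l = M" using dM by (simp add: l_def)
  have "l > 0" using l M d(1) by (metis zero_less_mult_pos)
  have dm: "d * int j \<in> G" for j
  proof (induction j)
    case 0
    then show ?case using Y0 YH by (auto simp: G_def)
  next
    case (Suc j)
    have "(d mod M + (d * int j) mod M) mod M \<in> H"
      using mod_sumset_closed[OF M Y(1) symY, of "d mod M" "(d * int j) mod M"] small d(2) Suc
      by (simp add: G_def H_def)
    then show ?case by (simp add: G_def mod_simps algebra_simps)
  qed
  \<comment> \<open>The \<open>l = M div d\<close> multiples of \<open>d\<close> below
    \<open>M\<close> are distinct elements of \<open>H\<close>, so \<open>l\<close> is at most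
    \<open>card H\<close>.\<close>
  have "(\<lambda>j. d * j) ` {0..<l} \<subseteq> H"
  proof
    fix z assume "z \<in> (\<lambda>j. d * j) ` {0..<l}"
    then obtain j where j: "z = d * j" "0 \<le> j" "j < l" by (blast dest: atLeastLessThan_iff[THEN iffD1])
    have "z < M" unfolding l[symmetric] j(1) using j d(1) by simp
    moreover have "0 \<le> z" using j d by simp
    moreover have "z \<in> G" using dm[of "nat j"] j by simp
    ultimately show "z \<in> H" by (simp add: G_def)
  qed
  then have "card ((\<lambda>j. d * j) ` {0..<l}) \<le> card H" using H by (intro card_mono) auto
  moreover have "card ((\<lambda>j. d * j) ` {0..<l}) = nat l"
    using d(1) by (subst card_image) (auto simp: inj_on_def)
  ultimately have "l \<le> s - 3 * k - 1" using cH by linarith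
  moreover have "d \<le> M" using dM M by (rule zdvd_imp_le)
  ultimately show ?thesis
    using d EG ME(1) bound by (intro exI[of _ d] exI[of _ l]) (auto simp: l)
qed

subsection \<open>Exits modulo a prime\<close>

text \<open>The Davenport transform \<open>X \<union> (Y + x)\<close>, \<open>Y \<inter> (X - x)\<close>, for \<open>x \<in> X\<close> and \<open>y \<in> Y\<close> with
  \<open>x + y \<notin> X\<close>, removes \<open>y\<close> from \<open>Y\<close>.\<close>

lemma cauchy_davenport_mod:
  fixes p :: nat
  assumes p: "prime p" and "X \<subseteq> {0..<int p}" "X \<noteq> {}" "Y \<subseteq> {0..<int p}" "0 \<in> Y"
  shows "min (int p) (int (card X) + int (card Y) - 1) \<le> int (card (mod_sumset (int p) X Y))"
  using assms(2-)
proof (induction "card Y" arbitrary: X Y rule: less_induct)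
  case less
  let ?p = "int p"
  have p0: "?p > 0" using p prime_gt_0_nat by simp
  have fX: "finite X" and fY: "finite Y" using less.prems finite_subset by blast+
  have fS: "finite (mod_sumset ?p X Y)" using fX fY by (simp add: mod_sumset_def)
  have xm: "x mod ?p = x" if "x \<in> X" for x using that less.prems(1) by (intro mod_pos_pos_trivial) auto
  have ym: "y mod ?p = y" if "y \<in> Y" for y using that less.prems(3) by (intro mod_pos_pos_trivial) auto
  have XS: "X \<subseteq> mod_sumset ?p X Y"
  proof
    fix x assume x: "x \<in> X"
    have "(x + 0) mod ?p \<in> mod_sumset ?p X Y" using x less.prems(4) by (rule mod_sumsetI)
    then show "x \<in> mod_sumset ?p X Y" using xm[OF x] by simp
  qed
  show ?case
  proof (cases "\<exists>x\<in>X. \<exists>y\<in>Y. (x + y) mod ?p \<notin> X")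
    case True
    then obtain x y where xy: "x \<in> X" "y \<in> Y" "(x + y) mod ?p \<notin> X" by blast
    define Y1 where "Y1 = {z \<in> Y. (z + x) mod ?p \<in> X}"
    define X1 where "X1 = X \<union> (\<lambda>z. (z + x) mod ?p) ` (Y - Y1)"
    \<comment> \<open>The element \<open>0\<close> survives because \<open>x\<close> lies in
      \<open>X\<close>, so the induction hypothesis applies to the transformed pair.\<close>
    have Y1: "Y1 \<subseteq> Y" "0 \<in> Y1" "y \<notin> Y1"
      using less.prems(4) xm[OF xy(1)] xy by (auto simp: Y1_def add.commute)
    have lt: "card Y1 < card Y" using Y1 xy(2) fY by (intro psubset_card_mono) auto
    have cX1: "card X1 = card X + (card Y - card Y1)"
    proof -
      have "card X1 = card X + card ((\<lambda>z. (z + x) mod ?p) ` (Y - Y1))"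
        unfolding X1_def by (rule card_Un_disjoint) (use fX fY in \<open>auto simp: Y1_def\<close>)
      also have "card ((\<lambda>z. (z + x) mod ?p) ` (Y - Y1)) = card (Y - Y1)"
        by (rule card_image_add_mod[OF p0]) (use less.prems(3) in auto)
      also have "card (Y - Y1) = card Y - card Y1"
        using Y1(1) fY finite_subset by (intro card_Diff_subset) auto
      finally show ?thesis .
    qed
    have "mod_sumset ?p X1 Y1 \<subseteq> mod_sumset ?p X Y"
    proof
      fix w assume "w \<in> mod_sumset ?p X1 Y1"
      then obtain u v where uv: "u \<in> X1" "v \<in> Y1" "w = (u + v) mod ?p" by (rule mod_sumsetE)
      show "w \<in> mod_sumset ?p X Y"
      proof (cases "u \<in> X")
        case True
        then show ?thesis using uv Y1(1) by (auto intro: mod_sumsetI)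
      next
        case False
        then obtain z where z: "z \<in> Y" "u = (z + x) mod ?p" using uv(1) by (auto simp: X1_def)
        have "((v + x) mod ?p + z) mod ?p = w"
          unfolding uv(3) z(2) by (simp add: mod_simps algebra_simps)
        moreover have "(v + x) mod ?p \<in> X" using uv(2) by (simp add: Y1_def)
        ultimately show ?thesis using z(1) mod_sumsetI by metis
      qed
    qed
    then have "card (mod_sumset ?p X1 Y1) \<le> card (mod_sumset ?p X Y)" by (rule card_mono[OF fS])
    moreover have "min ?p (int (card X1) + int (card Y1) - 1) \<le> int (card (mod_sumset ?p X1 Y1))"
    proof (rule less.hyps[OF lt])
      show "X1 \<subseteq> {0..<?p}" using less.prems(1) p0 by (auto simp: X1_def)
    qed (use less.prems Y1 in \<open>auto simp: X1_def\<close>)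
    ultimately show ?thesis using cX1 lt by linarith
  next
    case False
    show ?thesis
    proof (cases "Y = {0}")
      case True
      have "card X \<le> card (mod_sumset ?p X Y)" by (rule card_mono[OF fS XS])
      then show ?thesis using True by simp
    next
      case False
      then obtain y where y: "y \<in> Y" "y \<noteq> 0" using less.prems(4) by blast
      obtain x where x: "x \<in> X" using less.prems(2) by blast
      \<comment> \<open>Here \<open>X\<close> is closed under adding elements of \<open>Y\<close>;
        the multiples of a nonzero \<open>y\<close> run through all residues, so \<open>X\<close> is
        everything.\<close>
      have step: "(x + int j * y) mod ?p \<in> X" for j
      proof (induction j)
        case 0
        then show ?case using xm x by simp
      next
        case (Suc j)
        have "((x + int j * y) mod ?p + y) mod ?p \<in> X"
          using \<open>\<not> (\<exists>x\<in>X. \<exists>y\<in>Y. (x + y) mod ?p \<notin> X)\<close> Suc y(1) by blast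
        then show ?case by (simp add: mod_simps algebra_simps)
      qed
      have "inj_on (\<lambda>j. (x + int j * y) mod ?p) {..<p}"
      proof (rule inj_onI)
        fix i j assume ij: "i \<in> {..<p}" "j \<in> {..<p}" "(x + int i * y) mod ?p = (x + int j * y) mod ?p"
        then have "?p dvd (int i - int j) * y" by (simp add: mod_eq_dvd_iff algebra_simps)
        moreover have "\<not> ?p dvd y" using y less.prems(3) zdvd_not_zless[of y ?p] by force
        ultimately have "?p dvd int i - int j" using p by (simp add: prime_dvd_mult_iff)
        then show "i = j" using ij(1,2) zdvd_imp_le[of ?p "\<bar>int i - int j\<bar>"] by (cases "i = j") auto
      qed
      then have "card ((\<lambda>j. (x + int j * y) mod ?p) ` {..<p}) = p" by (simp add: card_image)
      moreover have "card ((\<lambda>j. (x + int j * y) mod ?p) ` {..<p}) \<le> card (mod_sumset ?p X Y)"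
        by (rule card_mono[OF fS]) (use step XS in blast)
      ultimately show ?thesis by simp
    qed
  qed
qed

text \<open>Counts the elements of \<open>A\<close> that leave \<open>A\<close>, rather than the
  elements of \<open>A + b\<close> outside \<open>A\<close>; translation identifies the two. The
  shift \<open>b\<close> may be any integer.\<close>

definition mod_exits :: "int \<Rightarrow> int set \<Rightarrow> int \<Rightarrow> nat" where
  "mod_exits p A b = card {a \<in> A. (a + b) mod p \<notin> A}"

lemma mod_exits_mod: "mod_exits p A (b mod p) = mod_exits p A b"
  by (simp add: mod_exits_def mod_simps)

lemma mod_exits_0: "A \<subseteq> {0..<p} \<Longrightarrow> mod_exits p A 0 = 0"
proof -
  assume "A \<subseteq> {0..<p}"
  then have "{a \<in> A. (a + 0) mod p \<notin> A} = {}" by auto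
  then show ?thesis unfolding mod_exits_def by (simp only: card.empty)
qed

lemma card_mod_stays:
  assumes "finite A"
  shows "int (card {a \<in> A. (a + b) mod p \<in> A}) = int (card A) - int (mod_exits p A b)"
proof -
  have "A = {a \<in> A. (a + b) mod p \<in> A} \<union> {a \<in> A. (a + b) mod p \<notin> A}" by auto
  then have "card A = card ({a \<in> A. (a + b) mod p \<in> A} \<union> {a \<in> A. (a + b) mod p \<notin> A})" by simp
  also have "\<dots> = card {a \<in> A. (a + b) mod p \<in> A} + card {a \<in> A. (a + b) mod p \<notin> A}"
    by (rule card_Un_disjoint) (use assms in auto)
  finally show ?thesis by (simp add: mod_exits_def)
qed

lemma mod_exits_le_card: "finite A \<Longrightarrow> mod_exits p A b \<le> card A"
  unfolding mod_exits_def by (intro card_mono) auto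

lemma mod_exits_uminus:
  fixes p :: int
  assumes "A \<subseteq> {0..<p}"
  shows "mod_exits p A (- b) = mod_exits p A b"
proof -
  have fin: "finite A" using assms finite_subset by blast
  have am: "a mod p = a" if "a \<in> A" for a using that assms by (intro mod_pos_pos_trivial) auto
  have "bij_betw (\<lambda>a. (a + b) mod p) {a \<in> A. (a + b) mod p \<in> A} {a \<in> A. (a + - b) mod p \<in> A}"
    by (rule bij_betw_byWitness[where f' = "\<lambda>a. (a - b) mod p"]) (auto simp: mod_simps am)
  then have "card {a \<in> A. (a + b) mod p \<in> A} = card {a \<in> A. (a + - b) mod p \<in> A}"
    by (rule bij_betw_same_card)
  then show ?thesis
    using card_mod_stays[OF fin, of b p] card_mod_stays[OF fin, of "- b" p] by linarith
qed

text \<open>An element leaving under \<open>b + c\<close> either leaves under \<open>b\<close>, or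
  is moved by \<open>b\<close> to an element of \<open>A\<close> that leaves under
  \<open>c\<close>.\<close>

lemma mod_exits_add:
  fixes p :: int
  assumes p: "p > 0" and A: "A \<subseteq> {0..<p}"
  shows "mod_exits p A (b + c) \<le> mod_exits p A b + mod_exits p A c"
proof -
  have fin: "finite A" using assms finite_subset by blast
  let ?T = "{a \<in> A. (a + b) mod p \<in> A \<and> (a + b + c) mod p \<notin> A}"
  have "{a \<in> A. (a + (b + c)) mod p \<notin> A} \<subseteq> {a \<in> A. (a + b) mod p \<notin> A} \<union> ?T"
    by (auto simp: add.assoc)
  then have "mod_exits p A (b + c) \<le> card ({a \<in> A. (a + b) mod p \<notin> A} \<union> ?T)"
    unfolding mod_exits_def using fin by (intro card_mono) auto
  also have "\<dots> \<le> mod_exits p A b + card ?T"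
    unfolding mod_exits_def by (rule card_Un_le)
  also have "card ?T = card ((\<lambda>a. (a + b) mod p) ` ?T)"
    by (rule card_image_add_mod[OF p, symmetric]) (use A in auto)
  also have "\<dots> \<le> mod_exits p A c"
    unfolding mod_exits_def using fin by (intro card_mono) (auto simp: mod_simps)
  finally show ?thesis by simp
qed

text \<open>Every ordered pair of elements of \<open>A\<close> is counted once, by its
  difference.\<close>

lemma sum_mod_stays:
  fixes p :: int
  assumes p: "p > 0" and A: "A \<subseteq> {0..<p}"
  shows "(\<Sum>b\<in>{0..<p}. int (card A) - int (mod_exits p A b)) = int (card A) * int (card A)"
proof -
  have fin: "finite A" using assms finite_subset by blast
  have "(\<Sum>b\<in>{0..<p}. int (card A) - int (mod_exits p A b))
      = (\<Sum>b\<in>{0..<p}. \<Sum>a\<in>A. of_bool ((b + a) mod p \<in> A))"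
    using fin by (intro sum.cong) (auto simp: card_mod_stays[symmetric] sum_of_bool_eq Int_def add.commute)
  also have "\<dots> = (\<Sum>a\<in>A. \<Sum>b\<in>{0..<p}. of_bool ((b + a) mod p \<in> A))" by (rule sum.swap)
  also have "\<dots> = (\<Sum>a\<in>A. \<Sum>b\<in>{0..<p}. of_bool (b \<in> A))"
    by (intro sum.cong refl sum_add_mod[OF p])
  also have "\<dots> = int (card A) * int (card A)"
    using A by (simp add: sum_of_bool_eq Int_absorb1)
  finally show ?thesis .
qed

section \<open>Level sets of the exit count and their growth\<close>

definition few_exits :: "int \<Rightarrow> int set \<Rightarrow> nat \<Rightarrow> int set" where
  "few_exits p A t = {b \<in> {0..<p}. mod_exits p A b \<le> t}"

lemma finite_few_exits: "finite (few_exits p A t)"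
  by (rule finite_subset[of _ "{0..<p}"]) (auto simp: few_exits_def)

text \<open>By subadditivity, adding \<open>E\<close> to the level set for \<open>j * t\<close>
  stays within the one for \<open>(j + 1) * t\<close>; by Cauchy-Davenport each addition gains
  \<open>card E - 1\<close> residues, up to \<open>p\<close>.\<close>

lemma card_few_exits_mult:
  fixes p :: nat
  assumes p: "prime p" and A: "A \<subseteq> {0..<int p}" and E: "E \<subseteq> few_exits (int p) A t" "0 \<in> E"
  shows "min (int p) (int j * (int (card E) - 1) + 1) \<le> int (card (few_exits (int p) A (j * t)))"
proof (induction j)
  case 0
  have "p > 0" using p prime_gt_0_nat by simp
  then have "0 \<in> few_exits (int p) A (0 * t)" using mod_exits_0[OF A] by (simp add: few_exits_def)
  then have "1 \<le> card (few_exits (int p) A (0 * t))"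
    using finite_few_exits by (metis One_nat_def Suc_le_eq card_gt_0_iff empty_iff)
  then show ?case by simp
next
  case (Suc j)
  have p0: "int p > 0" using p prime_gt_0_nat by simp
  let ?S = "\<lambda>t. few_exits (int p) A t"
  have 0: "0 \<in> ?S (j * t)" using mod_exits_0[OF A] p0 by (simp add: few_exits_def)
  have EP: "E \<subseteq> {0..<int p}" using E(1) by (auto simp: few_exits_def)
  have cE: "card E \<ge> 1" using E(2) EP finite_subset[OF EP] by (auto simp: Suc_le_eq card_gt_0_iff)
  have "mod_sumset (int p) (?S (j * t)) E \<subseteq> ?S (Suc j * t)"
  proof
    fix z assume "z \<in> mod_sumset (int p) (?S (j * t)) E"
    then obtain x y where xy: "x \<in> ?S (j * t)" "y \<in> E" "z = (x + y) mod int p" by (rule mod_sumsetE)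
    have "mod_exits (int p) A z \<le> mod_exits (int p) A x + mod_exits (int p) A y"
      unfolding xy(3) mod_exits_mod by (rule mod_exits_add[OF p0 A])
    also have "\<dots> \<le> Suc j * t" using xy(1,2) E(1) by (force simp: few_exits_def)
    finally show "z \<in> ?S (Suc j * t)" using xy(3) p0 by (simp add: few_exits_def)
  qed
  then have "card (mod_sumset (int p) (?S (j * t)) E) \<le> card (?S (Suc j * t))"
    by (rule card_mono[OF finite_few_exits])
  moreover have "min (int p) (int (card (?S (j * t))) + int (card E) - 1)
      \<le> int (card (mod_sumset (int p) (?S (j * t)) E))"
  proof (rule cauchy_davenport_mod[OF p _ _ EP E(2)])
    show "?S (j * t) \<noteq> {}" using 0 by blast
  qed (auto simp: few_exits_def)
  ultimately have "min (int p) (int (card (?S (j * t))) + int (card E) - 1) \<le> int (card (?S (Suc j * t)))"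
    by linarith
  then show ?case using Suc cE by (auto simp: min_def algebra_simps split: if_splits)
qed

text \<open>Evaluates the parabola summed over the layers below; the factor \<open>3\<close> avoids
  fractions.\<close>

lemma sum_quadratic_minorant:
  "3 * (\<Sum>k<n. 22 * int k * K - 2 * int k ^ 2) = 33 * K * int n * (int n - 1) - int n * (int n - 1) * (2 * int n - 1)"
  by (induction n) (auto simp: algebra_simps power2_eq_square)

text \<open>Sum the layers \<open>few_exits p A (k * t)\<close>; the parabola \<open>22 k K - 2 k\<^sup>2\<close> lies below both
  constraints coming from the minimum in \<open>card_few_exits_mult\<close>.\<close>

lemma card_few_exits_less:
  fixes p :: nat
  assumes p: "prime p" and A: "A \<subseteq> {0..<int p}" "2 * card A < p"
    and E: "E \<subseteq> few_exits (int p) A t" "0 \<in> E" and t: "t > 0" "200 * t \<le> card A"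
  shows "5 * (int (card E) - 1) < 11 * int t"
proof (rule ccontr)
  assume "\<not> 5 * (int (card E) - 1) < 11 * int t"
  define s where "s = int (card E) - 1"
  have s: "11 * int t \<le> 5 * s" using \<open>\<not> _\<close> by (simp add: s_def)
  have fA: "finite A" using A(1) finite_subset by blast
  have p0: "int p > 0" using p prime_gt_0_nat by simp
  define m where "m = card A"
  define K where "K = m div t"
  have K: "K * t \<le> m" "m < (K + 1) * t"
    using t(1) by (auto simp: K_def div_times_less_eq_dividend dividend_less_div_times)
  have K200: "200 \<le> K" using t by (simp add: K_def m_def less_eq_div_iff_mult_less_eq)
  have layer: "int t * int (card {k \<in> {..<K}. e \<le> k * t}) \<le> int m - int e" if e: "e \<le> m" for e
  proof -
    \<comment> \<open>This is \<open>e / t\<close> rounded up, the first layer that contains a shift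
      with \<open>e\<close> exits.\<close>
    define j where "j = (e + t - 1) div t"
    have j: "e \<le> j * t" "\<And>k. e \<le> k * t \<Longrightarrow> j \<le> k"
    proof -
      have "e + t - 1 < (j + 1) * t" using t(1) unfolding j_def by (metis Suc_eq_plus1 dividend_less_times_div mult.commute mult_Suc_right)
      then show "e \<le> j * t" by (simp add: algebra_simps)
      show "j \<le> k" if "e \<le> k * t" for k
      proof -
        have "e + t - 1 < (k + 1) * t" using that t(1) by (simp add: algebra_simps)
        then have "j < k + 1" unfolding j_def by (simp add: less_mult_imp_div_less)
        then show ?thesis by simp
      qed
    qed
    have "{k \<in> {..<K}. e \<le> k * t} \<subseteq> {j..<K}" using j(2) by auto
    then have "card {k \<in> {..<K}. e \<le> k * t} \<le> card {j..<K}" by (intro card_mono) auto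
    then have "t * card {k \<in> {..<K}. e \<le> k * t} \<le> t * (K - j)" by simp
    also have "\<dots> \<le> m - e" using K(1) j(1) by (simp add: algebra_simps diff_le_mono diff_le_mono2 le_diff_conv diff_mult_distrib2) 
    finally show ?thesis using e by (metis int_ops(7) of_nat_diff of_nat_le_iff)
  qed
  have low: "int t * (22 * int k * int K - 2 * int k ^ 2) \<le> 10 * int K * int (card (few_exits (int p) A (k * t)))"
    if k: "k < K" for k
  proof -
    have "int t * (22 * int k * int K - 2 * int k ^ 2) \<le> 10 * int K * min (int p) (int k * s + 1)"
    proof (cases "int p \<le> int k * s + 1")
      case True
      \<comment> \<open>The product is \<open>20 * K * K - (22 * k * K - 2 * k ^ 2)\<close>, so the
        parabola stays below its value at \<open>k = K\<close>, where
        \<open>2 * K * t \<le> p\<close> is available.\<close>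
      have "0 \<le> (20 * int K - 2 * int k) * (int K - int k)" using k by (intro mult_nonneg_nonneg) auto
      then have "22 * int k * int K - 2 * int k ^ 2 \<le> 20 * int K * int K"
        by (simp add: algebra_simps power2_eq_square)
      then have "int t * (22 * int k * int K - 2 * int k ^ 2) \<le> int t * (20 * int K * int K)"
        by (intro mult_left_mono) auto
      also have "\<dots> = 10 * int K * (2 * (int K * int t))" by simp
      also have "\<dots> \<le> 10 * int K * int p"
      proof (rule mult_left_mono)
        have "int (K * t) \<le> int m" using K(1) by (rule of_nat_mono)
        then show "2 * (int K * int t) \<le> int p" using A(2) by (simp add: m_def)
      qed auto
      finally show ?thesis using True by (simp add: min_def)
    next
      case False
      have "int t * (22 * int k * int K - 2 * int k ^ 2) \<le> int t * (22 * int k * int K)"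
        by (intro mult_left_mono) auto
      also have "\<dots> = 2 * int K * int k * (11 * int t)" by simp
      also have "\<dots> \<le> 2 * int K * int k * (5 * s)" by (rule mult_left_mono[OF s]) auto
      also have "\<dots> \<le> 10 * int K * (int k * s + 1)" by (simp add: algebra_simps)
      finally show ?thesis using False by (simp add: min_def)
    qed
    also have "\<dots> \<le> 10 * int K * int (card (few_exits (int p) A (k * t)))"
      using card_few_exits_mult[OF p A(1) E, of k] by (intro mult_left_mono) (auto simp: s_def)
    finally show ?thesis .
  qed
  have "int t * (\<Sum>k<K. int (card (few_exits (int p) A (k * t))))
      = int t * (\<Sum>k<K. \<Sum>b\<in>{0..<int p}. of_bool (mod_exits (int p) A b \<le> k * t))"
    by (simp add: few_exits_def sum_of_bool_eq Int_def)
  also have "\<dots> = int t * (\<Sum>b\<in>{0..<int p}. \<Sum>k<K. of_bool (mod_exits (int p) A b \<le> k * t))"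
    by (subst sum.swap) simp
  also have "\<dots> = (\<Sum>b\<in>{0..<int p}. int t * int (card {k \<in> {..<K}. mod_exits (int p) A b \<le> k * t}))"
    by (simp add: sum_distrib_left[symmetric] sum_of_bool_eq Int_def)
  also have "\<dots> \<le> (\<Sum>b\<in>{0..<int p}. int m - int (mod_exits (int p) A b))"
    by (intro sum_mono layer) (simp add: m_def mod_exits_le_card[OF fA])
  also have "\<dots> = int m * int m" unfolding m_def by (rule sum_mod_stays[OF p0 A(1)])
  finally have up: "int t * (\<Sum>k<K. int (card (few_exits (int p) A (k * t)))) \<le> int m * int m" .
  have "int t * int t * (3 * (\<Sum>k<K. 22 * int k * int K - 2 * int k ^ 2))
      = 3 * int t * (\<Sum>k<K. int t * (22 * int k * int K - 2 * int k ^ 2))"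
    by (simp add: sum_distrib_left algebra_simps)
  also have "\<dots> \<le> 3 * int t * (\<Sum>k<K. 10 * int K * int (card (few_exits (int p) A (k * t))))"
    by (intro mult_left_mono sum_mono low) auto
  also have "\<dots> = 30 * int K * (int t * (\<Sum>k<K. int (card (few_exits (int p) A (k * t)))))"
    by (simp add: sum_distrib_left algebra_simps)
  also have "\<dots> \<le> 30 * int K * (int m * int m)" by (intro mult_left_mono up) auto
  also have "\<dots> < 30 * int K * ((int K + 1) * int t * ((int K + 1) * int t))"
  proof -
    have "int m < (int K + 1) * int t" using K(2) by (metis of_nat_1 of_nat_add of_nat_less_iff of_nat_mult)
    then have "int m * int m < (int K + 1) * int t * ((int K + 1) * int t)"
      by (intro mult_strict_mono) auto
    then show ?thesis using K200 by (intro mult_strict_left_mono) auto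
  qed
  finally have "int t * int t * (3 * (\<Sum>k<K. 22 * int k * int K - 2 * int k ^ 2))
      < int t * int t * (30 * int K * (int K + 1) * (int K + 1))"
    by (simp only: mult_ac)
  then have "3 * (\<Sum>k<K. 22 * int k * int K - 2 * int k ^ 2) < 30 * int K * (int K + 1) * (int K + 1)"
    using t(1) by (simp add: mult_less_cancel_left)
  then have "33 * int K * int K * (int K - 1) - int K * (int K - 1) * (2 * int K - 1)
      < 30 * int K * (int K + 1) * (int K + 1)"
    unfolding sum_quadratic_minorant .
  \<comment> \<open>The cubic coefficients are \<open>31\<close> on the left and \<open>30\<close>
    on the right. The remaining inequality fails for \<open>K \<ge> 200\<close>, which is what
    \<open>200 * t \<le> card A\<close> provides.\<close>
  then have "int K * (int K * int K) < int K * (90 * int K + 31)"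
    by (simp add: algebra_simps)
  then have "int K * int K < 90 * int K + 31" using K200 by simp
  moreover have "200 * int K \<le> int K * int K" using K200 by simp
  ultimately show False using K200 by simp
qed

subsection \<open>A concentrating frequency\<close>

text \<open>Orthogonality of characters: the real part of the geometric sum of a \<open>p\<close>-th
  root of unity.\<close>

lemma sum_cos_multiples:
  fixes p :: nat and z :: int
  assumes p: "p > 0"
  shows "(\<Sum>\<xi><p. cos (2 * pi * real \<xi> * real_of_int z / real p)) = (if int p dvd z then real p else 0)"
proof -
  define w where "w = cis (2 * pi * real_of_int z / real p)"
  have cos_eq: "cos (2 * pi * real \<xi> * real_of_int z / real p) = Re (w ^ \<xi>)" for \<xi>
    by (simp add: w_def DeMoivre mult_ac)
  have wp: "w ^ p = 1"
  proof -
    have "w ^ p = cis (2 * pi * real_of_int z)" using p by (simp add: w_def DeMoivre)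
    also have "\<dots> = 1" by (simp add: cis_multiple_2pi)
    finally show ?thesis .
  qed
  have w1: "w = 1 \<longleftrightarrow> int p dvd z"
  proof
    assume "w = 1"
    then have "cos (2 * pi * real_of_int z / real p) = 1" by (metis Re_complex_of_real cis.sel(1) of_real_1 w_def)
    then obtain k :: int where "2 * pi * real_of_int z / real p = real_of_int k * 2 * pi"
      by (auto simp: cos_one_2pi_int)
    then have "real_of_int z = real_of_int (k * int p)" using p by (simp add: field_simps)
    then have "z = k * int p" by (simp only: of_int_eq_iff)
    then show "int p dvd z" by simp
  next
    assume "int p dvd z"
    then obtain k where "z = int p * k" by blast
    then have "2 * pi * real_of_int z / real p = 2 * pi * real_of_int k" using p by (simp add: field_simps)
    then show "w = 1" by (simp add: w_def cis_multiple_2pi)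
  qed
  have "(\<Sum>\<xi><p. cos (2 * pi * real \<xi> * real_of_int z / real p)) = Re (\<Sum>\<xi><p. w ^ \<xi>)"
    by (simp add: cos_eq)
  also have "\<dots> = (if int p dvd z then real p else 0)"
  proof (cases "w = 1")
    case False
    then show ?thesis using w1 wp by (simp add: sum_gp_strict)
  qed (use w1 in auto)
  finally show ?thesis .
qed

text \<open>The squared modulus of the Fourier coefficient at \<xi> of the indicator of
  \<open>A\<close>, written through real and imaginary parts.\<close>

definition fourier_energy :: "nat \<Rightarrow> int set \<Rightarrow> nat \<Rightarrow> real" where
  "fourier_energy p A \<xi> = (\<Sum>a\<in>A. cos (2 * pi * real \<xi> * real_of_int a / real p))\<^sup>2
     + (\<Sum>a\<in>A. sin (2 * pi * real \<xi> * real_of_int a / real p))\<^sup>2"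

lemma fourier_energy_eq:
  "fourier_energy p A \<xi> = (\<Sum>a\<in>A. \<Sum>a'\<in>A. cos (2 * pi * real \<xi> * real_of_int (a - a') / real p))"
proof -
  have "cos (2 * pi * real \<xi> * real_of_int (a - a') / real p)
    = cos (2 * pi * real \<xi> * real_of_int a / real p) * cos (2 * pi * real \<xi> * real_of_int a' / real p)
    + sin (2 * pi * real \<xi> * real_of_int a / real p) * sin (2 * pi * real \<xi> * real_of_int a' / real p)" for a a'
    unfolding cos_diff[symmetric] by (simp add: algebra_simps diff_divide_distrib)
  then show ?thesis
    by (simp add: fourier_energy_def power2_eq_square sum_product sum.distrib)
qed

text \<open>Fourier inversion for the autocorrelation of \<open>A\<close>. The product of cosines
  splits into terms for \<open>b\<close> and \<open>- b\<close>, orthogonality selects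
  \<open>a' = a + b\<close> and \<open>a' = a - b\<close> modulo \<open>p\<close>, and both counts
  agree by \<open>mod_exits_uminus\<close>.\<close>

lemma sum_fourier_energy_cos:
  fixes p :: nat and b :: int
  assumes p: "p > 0" and A: "A \<subseteq> {0..<int p}"
  shows "(\<Sum>\<xi><p. fourier_energy p A \<xi> * cos (2 * pi * real \<xi> * real_of_int b / real p))
    = real p * (real (card A) - real (mod_exits (int p) A b))"
proof -
  have fin: "finite A" using A finite_subset by blast
  let ?c = "\<lambda>\<xi> z. cos (2 * pi * real \<xi> * real_of_int z / real p)"
  have prod: "?c \<xi> (a - a') * ?c \<xi> b = (?c \<xi> (a + b - a') + ?c \<xi> (a - b - a')) / 2" for \<xi> a a'
    unfolding cos_times_cos by (simp add: algebra_simps diff_divide_distrib add_divide_distrib)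
  have count: "(\<Sum>a'\<in>A. if int p dvd a + x - a' then real p else 0)
      = real p * of_bool ((a + x) mod int p \<in> A)" for a x
  proof -
    have "int p dvd a + x - a' \<longleftrightarrow> a' = (a + x) mod int p" if "a' \<in> A" for a'
    proof -
      have "a' mod int p = a'" using that A by (intro mod_pos_pos_trivial) auto
      then show ?thesis using mod_eq_dvd_iff[of "a + x" "int p" a'] by auto
    qed
    then have "(\<Sum>a'\<in>A. if int p dvd a + x - a' then real p else 0)
       = (\<Sum>a'\<in>A. if a' = (a + x) mod int p then real p else 0)" by (intro sum.cong) auto
    then show ?thesis using fin by simp
  qed
  have stays: "(\<Sum>a\<in>A. of_bool ((a + x) mod int p \<in> A)) = real (card A) - real (mod_exits (int p) A x)" for x
  proof -
    have "(\<Sum>a\<in>A. of_bool ((a + x) mod int p \<in> A)) = real (card {a \<in> A. (a + x) mod int p \<in> A})"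
      using fin by (simp add: sum_of_bool_eq Int_def)
    also have "\<dots> = real_of_int (int (card {a \<in> A. (a + x) mod int p \<in> A}))" by simp
    also have "\<dots> = real (card A) - real (mod_exits (int p) A x)"
      unfolding card_mod_stays[OF fin] by simp
    finally show ?thesis .
  qed
  have "(\<Sum>\<xi><p. fourier_energy p A \<xi> * ?c \<xi> b)
      = (\<Sum>\<xi><p. \<Sum>a\<in>A. \<Sum>a'\<in>A. (?c \<xi> (a + b - a') + ?c \<xi> (a - b - a')) / 2)"
    unfolding fourier_energy_eq sum_distrib_right prod ..
  also have "\<dots> = (\<Sum>a\<in>A. \<Sum>a'\<in>A. \<Sum>\<xi><p. (?c \<xi> (a + b - a') + ?c \<xi> (a - b - a')) / 2)"
    by (subst sum.swap, rule sum.cong[OF refl], rule sum.swap)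
  also have "\<dots> = (\<Sum>a\<in>A. \<Sum>a'\<in>A. ((if int p dvd a + b - a' then real p else 0)
       + (if int p dvd a + - b - a' then real p else 0)) / 2)"
    by (simp only: sum_divide_distrib[symmetric] sum.distrib sum_cos_multiples[OF p] diff_conv_add_uminus)
  also have "\<dots> = (\<Sum>a\<in>A. (real p * of_bool ((a + b) mod int p \<in> A) + real p * of_bool ((a + - b) mod int p \<in> A)) / 2)"
    by (simp only: sum_divide_distrib[symmetric] sum.distrib count)
  also have "\<dots> = (real p * (\<Sum>a\<in>A. of_bool ((a + b) mod int p \<in> A)) + real p * (\<Sum>a\<in>A. of_bool ((a + - b) mod int p \<in> A))) / 2"
    by (simp only: sum_divide_distrib[symmetric] sum.distrib sum_distrib_left)
  also have "\<dots> = real p * (real (card A) - real (mod_exits (int p) A b))"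
    unfolding stays mod_exits_uminus[OF A] by simp
  finally show ?thesis .
qed

text \<open>Average over \<open>\<xi> \<noteq> 0\<close> with weights \<open>fourier_energy\<close>; since \<open>2 |A| < p\<close>, the nonzero
  frequencies carry more than half of the total energy.\<close>

lemma exists_concentrating_frequency:
  fixes p :: nat
  assumes A: "A \<subseteq> {0..<int p}" "A \<noteq> {}" "2 * card A < p"
  shows "\<exists>\<xi>\<in>{1..<p}. real (card A) * (\<Sum>b\<in>E. 1 - cos (2 * pi * real \<xi> * real_of_int b / real p))
    \<le> 2 * real (\<Sum>b\<in>E. mod_exits (int p) A b)"
proof (rule ccontr)
  let ?W = "fourier_energy p A" and ?m = "real (card A)"
  define S where "S \<xi> = (\<Sum>b\<in>E. 1 - cos (2 * pi * real \<xi> * real_of_int b / real p))" for \<xi> :: nat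
  define R where "R = real (\<Sum>b\<in>E. mod_exits (int p) A b)"
  assume neg: "\<not> ?thesis"
  have big: "2 * R < ?m * S \<xi>" if "\<xi> \<in> {1..<p}" for \<xi>
    using neg that by (auto simp: S_def R_def not_le)
  have p: "p > 0" using A(3) by simp
  have fin: "finite A" using A finite_subset by blast
  have m: "?m > 0" using A(2) fin by (simp add: card_gt_0_iff)
  have W0: "?W 0 = ?m\<^sup>2" by (simp add: fourier_energy_def)
  have split: "(\<Sum>\<xi><p. f \<xi>) = f 0 + (\<Sum>\<xi>\<in>{1..<p}. f \<xi>)" for f :: "nat \<Rightarrow> real"
    using p sum.atLeast_Suc_lessThan[of 0 p f] by (simp add: lessThan_atLeast0)
  \<comment> \<open>Parseval with the energy \<open>?m\<^sup>2\<close> of the zero frequency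
    removed.\<close>
  have W: "(\<Sum>\<xi>\<in>{1..<p}. ?W \<xi>) = ?m * (real p - ?m)"
    using sum_fourier_energy_cos[OF p A(1), of 0] split[of ?W] W0 mod_exits_0[OF A(1)]
    by (simp add: algebra_simps power2_eq_square)
  have "(\<Sum>\<xi><p. ?W \<xi> * S \<xi>) = (\<Sum>b\<in>E. \<Sum>\<xi><p. ?W \<xi> * (1 - cos (2 * pi * real \<xi> * real_of_int b / real p)))"
    unfolding S_def sum_distrib_left by (rule sum.swap)
  also have "\<dots> = (\<Sum>b\<in>E. real p * real (mod_exits (int p) A b))"
  proof (rule sum.cong[OF refl])
    fix b
    show "(\<Sum>\<xi><p. ?W \<xi> * (1 - cos (2 * pi * real \<xi> * real_of_int b / real p)))
       = real p * real (mod_exits (int p) A b)"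
      using sum_fourier_energy_cos[OF p A(1), of 0] sum_fourier_energy_cos[OF p A(1), of b]
        mod_exits_0[OF A(1)]
      by (simp add: right_diff_distrib sum_subtractf)
  qed
  also have "\<dots> = real p * R" by (simp add: R_def sum_distrib_left)
  finally have WS: "(\<Sum>\<xi>\<in>{1..<p}. ?W \<xi> * S \<xi>) = real p * R"
    using split[of "\<lambda>\<xi>. ?W \<xi> * S \<xi>"] by (simp add: S_def)
  have "(\<Sum>\<xi>\<in>{1..<p}. ?W \<xi> * (?m * S \<xi> - 2 * R)) = ?m * (real p * R) - 2 * R * (?m * (real p - ?m))"
    unfolding WS[symmetric] W[symmetric]
    by (simp add: right_diff_distrib sum_subtractf sum_distrib_left mult_ac)
  also have "\<dots> = ?m * R * (2 * ?m - real p)" by (simp add: algebra_simps)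
  also have "\<dots> \<le> 0"
    by (rule mult_nonneg_nonpos) (use A(3) in \<open>auto simp: R_def sum_nonneg\<close>)
  finally have le: "(\<Sum>\<xi>\<in>{1..<p}. ?W \<xi> * (?m * S \<xi> - 2 * R)) \<le> 0" .
  have nn: "0 \<le> ?W \<xi> * (?m * S \<xi> - 2 * R)" if "\<xi> \<in> {1..<p}" for \<xi>
    using big[OF that] by (intro mult_nonneg_nonneg) (auto simp: fourier_energy_def)
  \<comment> \<open>Each second factor is strictly positive, so all energies at nonzero frequencies
    vanish, although their total \<open>?m * (p - ?m)\<close> is positive.\<close>
  have "(\<Sum>\<xi>\<in>{1..<p}. ?W \<xi> * (?m * S \<xi> - 2 * R)) = 0"
    using le nn by (meson antisym sum_nonneg)
  then have "?W \<xi> * (?m * S \<xi> - 2 * R) = 0" if "\<xi> \<in> {1..<p}" for \<xi>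
    using nn that by (subst (asm) sum_nonneg_eq_0_iff) auto
  then have "?W \<xi> = 0" if "\<xi> \<in> {1..<p}" for \<xi> using big that by fastforce
  then have "(\<Sum>\<xi>\<in>{1..<p}. ?W \<xi>) = 0" by simp
  moreover have "real p - ?m > 0" using A(3) by linarith
  ultimately show False using W m by simp
qed

text \<open>The angle has absolute value between \<open>pi / 4\<close> and \<open>pi\<close>, so its
  cosine is at most \<open>sqrt 2 / 2\<close>, which is at most \<open>5 / 7\<close> because
  \<open>100 / 49 \<ge> 2\<close>.\<close>

lemma one_minus_cos_ge:
  fixes p :: nat and x :: int
  assumes "p > 0" "int p \<le> 8 * \<bar>x\<bar>" "2 * \<bar>x\<bar> \<le> int p"
  shows "2 / 7 \<le> 1 - cos (2 * pi * real_of_int x / real p)"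
proof -
  define y where "y = 2 * pi * real_of_int \<bar>x\<bar> / real p"
  have "real_of_int (int p) \<le> real_of_int (8 * \<bar>x\<bar>)" "real_of_int (2 * \<bar>x\<bar>) \<le> real_of_int (int p)"
    using assms(2,3) by (simp_all only: of_int_le_iff)
  then have 1: "real p \<le> 8 * \<bar>real_of_int x\<bar>" "2 * \<bar>real_of_int x\<bar> \<le> real p" by simp_all
  have "pi / 4 \<le> y"
    using mult_left_mono[OF 1(1), of pi] assms(1) by (simp add: y_def field_simps)
  moreover have "y \<le> pi"
    using mult_left_mono[OF 1(2), of pi] assms(1) by (simp add: y_def field_simps)
  ultimately have "cos y \<le> cos (pi / 4)" by (intro cos_monotone_0_pi_le) auto
  also have "\<dots> = sqrt 2 / 2" by (rule cos_45)
  also have "\<dots> \<le> 5 / 7" using real_le_lsqrt[of "10/7" 2] by (simp add: power2_eq_square)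
  finally have "cos y \<le> 5 / 7" .
  moreover have "cos y = cos (2 * pi * real_of_int x / real p)"
    unfolding y_def by (cases "x \<ge> 0") auto
  ultimately show ?thesis by simp
qed

subsection \<open>Confinement to a short progression\<close>

text \<open>For odd positive \<open>p\<close>, the representative of \<open>z\<close> modulo
  \<open>p\<close> of least absolute value.\<close>

definition centered_residue :: "int \<Rightarrow> int \<Rightarrow> int" where
  "centered_residue p z = (z + p div 2) mod p - p div 2"

lemma centered_residue_cong: "centered_residue p z mod p = z mod p"
proof -
  have "centered_residue p z mod p = ((z + p div 2) - p div 2) mod p"
    unfolding centered_residue_def by (rule mod_diff_left_eq)
  then show ?thesis by simp
qed

lemma abs_centered_residue:
  assumes "odd p" "p > 0"
  shows "2 * \<bar>centered_residue p z\<bar> < p"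
proof -
  obtain h where h: "p = 2 * h + 1" using assms(1) by (rule oddE)
  then have "p div 2 = h" by simp
  moreover have "0 \<le> (z + h) mod p" "(z + h) mod p < p" using assms by auto
  ultimately show ?thesis using h by (simp add: centered_residue_def abs_if)
qed

lemma eq_if_cong_and_small:
  fixes x y p :: int
  assumes "x mod p = y mod p" "\<bar>x\<bar> + \<bar>y\<bar> < p"
  shows "x = y"
proof (rule ccontr)
  assume "x \<noteq> y"
  moreover have "p dvd x - y" using assms(1) by (simp add: mod_eq_dvd_iff)
  ultimately show False using dvd_imp_le_int[of "x - y" p] assms(2) by linarith
qed

lemma centered_residue_unique:
  assumes "odd p" "p > 0" "x mod p = z mod p" "2 * \<bar>x\<bar> < p"
  shows "centered_residue p z = x"
proof (rule eq_if_cong_and_small)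
  show "centered_residue p z mod p = x mod p" using assms(3) by (simp add: centered_residue_cong)
  show "\<bar>centered_residue p z\<bar> + \<bar>x\<bar> < p" using abs_centered_residue[OF assms(1,2), of z] assms(4) by linarith
qed

lemma card_symmetric_set:
  fixes E :: "int set"
  assumes "finite E" "0 \<in> E" "\<And>e. e \<in> E \<Longrightarrow> - e \<in> E"
  shows "card E = 2 * card {e \<in> E. e > 0} + 1"
proof -
  have "E = ({e \<in> E. e > 0} \<union> uminus ` {e \<in> E. e > 0}) \<union> {0}"
  proof
    show "E \<subseteq> ({e \<in> E. e > 0} \<union> uminus ` {e \<in> E. e > 0}) \<union> {0}"
    proof
      fix e assume e: "e \<in> E"
      show "e \<in> ({e \<in> E. e > 0} \<union> uminus ` {e \<in> E. e > 0}) \<union> {0}"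
        using e assms(3)[OF e] by (cases "e < 0") (auto intro: image_eqI[of e uminus "- e"])
    qed
  qed (use assms in auto)
  then have "card E = card (({e \<in> E. e > 0} \<union> uminus ` {e \<in> E. e > 0}) \<union> {0})" by simp
  also have "\<dots> = card ({e \<in> E. e > 0} \<union> uminus ` {e \<in> E. e > 0}) + 1"
    using assms(1) by (subst card_Un_disjoint) auto
  also have "card ({e \<in> E. e > 0} \<union> uminus ` {e \<in> E. e > 0})
      = card {e \<in> E. e > 0} + card (uminus ` {e \<in> E. e > 0})"
    using assms(1) by (subst card_Un_disjoint) auto
  also have "card (uminus ` {e \<in> E. e > 0}) = card {e \<in> E. e > 0}"
    by (rule card_image) simp
  finally show ?thesis by simp
qed

definition centered_dilate :: "int \<Rightarrow> int \<Rightarrow> int set \<Rightarrow> int set" where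
  "centered_dilate p u E = (\<lambda>b. centered_residue p (u * b)) ` E"

text \<open>Sums of two elements of absolute value below \<open>p / 4\<close> do not wrap around, so
  reduction modulo \<open>p\<close> is injective on the integer sumset.\<close>

lemma card_int_sumset_le:
  fixes p :: int and E F :: "int set"
  assumes p: "p > 0" and F: "finite F" "E \<subseteq> F" and small: "\<And>e. e \<in> E \<Longrightarrow> 4 * \<bar>e\<bar> < p"
  shows "card ((\<lambda>(a, b). a + b) ` (E \<times> E)) \<le> card (mod_sumset p F F)"
proof -
  have "inj_on (\<lambda>z. z mod p) ((\<lambda>(a, b). a + b) ` (E \<times> E))"
  proof (rule inj_onI)
    fix x y assume x: "x \<in> (\<lambda>(a, b). a + b) ` (E \<times> E)" and y: "y \<in> (\<lambda>(a, b). a + b) ` (E \<times> E)"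
      and xy: "x mod p = y mod p"
    obtain a b where ab: "a \<in> E" "b \<in> E" "x = a + b" using x by auto
    obtain c d where cd: "c \<in> E" "d \<in> E" "y = c + d" using y by auto
    have "\<bar>x\<bar> + \<bar>y\<bar> \<le> \<bar>a\<bar> + \<bar>b\<bar> + \<bar>c\<bar> + \<bar>d\<bar>" using ab(3) cd(3) by linarith
    also have "\<dots> < p" using small[OF ab(1)] small[OF ab(2)] small[OF cd(1)] small[OF cd(2)] by linarith
    finally show "x = y" by (rule eq_if_cong_and_small[OF xy])
  qed
  then have "card ((\<lambda>(a, b). a + b) ` (E \<times> E)) = card ((\<lambda>z. z mod p) ` (\<lambda>(a, b). a + b) ` (E \<times> E))"
    by (simp add: card_image)
  also have "\<dots> \<le> card (mod_sumset p F F)"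
    by (rule card_mono) (use F in \<open>auto simp: mod_sumset_def\<close>)
  finally show ?thesis .
qed

lemma unit_inverse_mod:
  fixes p :: nat and d :: int
  assumes "prime p" "0 < d" "d < int p"
  obtains v where "(v * d) mod int p = 1 mod int p" "\<not> int p dvd v"
proof -
  have "\<not> int p dvd d" using assms zdvd_not_zless by blast
  then have "coprime (int p) d" using assms(1) by (simp add: prime_imp_coprime)
  then obtain x y where xy: "x * int p + y * d = 1"
    using bezout_int[of "int p" d] by auto
  have "y * d = 1 - x * int p" using xy by simp
  then have "(y * d) mod int p = (1 - x * int p) mod int p" by simp
  also have "\<dots> = 1 mod int p" by (simp add: mod_diff_eq[symmetric])
  finally have *: "(y * d) mod int p = 1 mod int p" .
  moreover have "\<not> int p dvd y"
  proof
    assume "int p dvd y"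
    then have "int p dvd x * int p + y * d" by simp
    then have "int p dvd 1" by (simp only: xy)
    then show False using prime_gt_1_nat[OF assms(1)] by simp
  qed
  ultimately show thesis by (rule that)
qed

text \<open>The set \<open>D\<close> of the overview, given by integer representatives:
  \<open>E\<close> is symmetric in the integers, while distinctness modulo \<open>p\<close> is a
  separate assumption.\<close>

locale symmetric_residues =
  fixes p :: nat and E :: "int set" and n :: nat
  assumes prime: "prime p" and odd: "odd p"
    and fin: "finite E" and zero: "0 \<in> E" and sym: "\<And>e. e \<in> E \<Longrightarrow> - e \<in> E"
    and inj: "inj_on (\<lambda>e. e mod int p) E" and card: "card E = 2 * n + 1"
begin

abbreviation "ER u \<equiv> centered_dilate (int p) u E"

lemma p_pos: "int p > 0" and odd_int: "odd (int p)"
  using prime prime_gt_0_nat odd by auto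

lemma finite_ER: "finite (ER u)"
  using fin by (simp add: centered_dilate_def)

lemma abs_ER: "e \<in> ER u \<Longrightarrow> 2 * \<bar>e\<bar> < int p"
  using abs_centered_residue[OF odd_int p_pos] by (auto simp: centered_dilate_def)

lemma zero_ER: "0 \<in> ER u"
proof -
  have "centered_residue (int p) (u * 0) = 0"
    by (rule centered_residue_unique[OF odd_int p_pos]) (use p_pos in auto)
  then show ?thesis using zero by (force simp: centered_dilate_def)
qed

lemma sym_ER: assumes "e \<in> ER u" shows "- e \<in> ER u"
proof -
  obtain b where b: "b \<in> E" "e = centered_residue (int p) (u * b)"
    using assms by (auto simp: centered_dilate_def)
  have "centered_residue (int p) (u * - b) = - e"
  proof (rule centered_residue_unique[OF odd_int p_pos])
    show "(- e) mod int p = (u * - b) mod int p"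
      using mod_minus_cong[OF centered_residue_cong[of "int p" "u * b"]] by (simp add: b(2))
    show "2 * \<bar>- e\<bar> < int p" using abs_ER[OF assms] by simp
  qed
  then show ?thesis using sym[OF b(1)] by (force simp: centered_dilate_def)
qed

lemma inj_ER:
  assumes "\<not> int p dvd u"
  shows "inj_on (\<lambda>b. centered_residue (int p) (u * b)) E"
proof (rule inj_onI)
  fix x y assume xy: "x \<in> E" "y \<in> E" "centered_residue (int p) (u * x) = centered_residue (int p) (u * y)"
  then have "(u * x) mod int p = (u * y) mod int p" by (metis centered_residue_cong)
  then have "int p dvd u * (x - y)" by (simp add: mod_eq_dvd_iff algebra_simps)
  then have "int p dvd x - y" using assms prime by (simp add: prime_dvd_mult_iff)
  then have "x mod int p = y mod int p" by (simp add: mod_eq_dvd_iff)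
  then show "x = y" using inj xy(1,2) by (auto dest: inj_onD)
qed

lemma card_ER: "\<not> int p dvd u \<Longrightarrow> card (ER u) = 2 * n + 1"
  by (simp add: centered_dilate_def card_image inj_ER card)

lemma card_sumset_ER:
  "card (mod_sumset (int p) (ER u) (ER u)) \<le> card (mod_sumset (int p) E E)"
proof -
  have "mod_sumset (int p) (ER u) (ER u) \<subseteq> (\<lambda>z. (u * z) mod int p) ` mod_sumset (int p) E E"
  proof
    fix w assume "w \<in> mod_sumset (int p) (ER u) (ER u)"
    then obtain x y where xy: "x \<in> ER u" "y \<in> ER u" "w = (x + y) mod int p" by (rule mod_sumsetE)
    obtain a b where ab: "a \<in> E" "b \<in> E" "x = centered_residue (int p) (u * a)"
      "y = centered_residue (int p) (u * b)"
      using xy(1,2) by (auto simp: centered_dilate_def)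
    have "w = (x mod int p + y mod int p) mod int p" using xy(3) by (simp add: mod_simps)
    also have "\<dots> = (u * ((a + b) mod int p)) mod int p"
      unfolding ab(3,4) centered_residue_cong by (simp add: mod_simps algebra_simps)
    finally show "w \<in> (\<lambda>z. (u * z) mod int p) ` mod_sumset (int p) E E"
      using ab(1,2) mod_sumsetI by blast
  qed
  moreover have "finite (mod_sumset (int p) E E)" using fin by (simp add: mod_sumset_def)
  ultimately show ?thesis by (meson card_image_le card_mono finite_imageI order_trans)
qed

text \<open>Used to turn a progression with difference \<open>d\<close> into an interval: dilating
  further by the inverse \<open>v\<close> of \<open>d\<close> sends \<open>d * c\<close> to
  \<open>c\<close>.\<close>

lemma cong_ER:
  assumes "b \<in> E" "(v * d) mod int p = 1 mod int p" "e = centered_residue (int p) (u * b)"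
    "e mod int p = (d * c) mod int p"
  shows "(v * u * b) mod int p = c mod int p"
proof -
  have "(v * u * b) mod int p = (v * (e mod int p)) mod int p"
    unfolding assms(3) centered_residue_cong by (simp add: mod_simps mult.assoc)
  also have "\<dots> = ((v * d) mod int p * c) mod int p"
    unfolding assms(4) by (simp add: mod_simps mult.assoc)
  also have "\<dots> = c mod int p" unfolding assms(2) by (simp add: mod_simps)
  finally show ?thesis .
qed

section \<open>From few exits to a short interval of residues\<close>

text \<open>The concentrating frequency serves as dilation. Each residue of absolute value at least
  \<open>p / 8\<close> adds at least \<open>2 / 7\<close> to the sum of \<open>1 - cos\<close>, and
  that sum is at most \<open>2 * (2 * n + 1) * n / card A\<close>, hence at most
  \<open>(2 * n + 1) / 500\<close>.\<close>

lemma exists_large_cluster: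
  assumes A: "A \<subseteq> {0..<int p}" "2 * card A < p" "1000 * n \<le> card A" "n > 0"
    and \<Delta>: "\<And>b. b \<in> E \<Longrightarrow> mod_exits (int p) A b \<le> n"
  shows "\<exists>u. \<not> int p dvd u \<and> 1000 * card {e \<in> ER u. int p \<le> 8 * \<bar>e\<bar>} \<le> 7 * (2 * n + 1)"
proof -
  have A0: "A \<noteq> {}" using A by auto
  obtain \<xi> where \<xi>: "\<xi> \<in> {1..<p}" "real (card A) * (\<Sum>b\<in>E. 1 - cos (2 * pi * real \<xi> * real_of_int b / real p))
    \<le> 2 * real (\<Sum>b\<in>E. mod_exits (int p) A b)"
    using exists_concentrating_frequency[OF A(1) A0 A(2), of E] by blast
  have u: "\<not> int p dvd int \<xi>" using \<xi>(1) by (auto dest: nat_dvd_not_less)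
  define T where "T = {b \<in> E. int p \<le> 8 * \<bar>centered_residue (int p) (int \<xi> * b)\<bar>}"
  have fT: "finite T" using fin by (simp add: T_def)
  have cT: "card {e \<in> ER (int \<xi>). int p \<le> 8 * \<bar>e\<bar>} \<le> card T"
  proof -
    have "{e \<in> ER (int \<xi>). int p \<le> 8 * \<bar>e\<bar>} = (\<lambda>b. centered_residue (int p) (int \<xi> * b)) ` T"
      by (auto simp: T_def centered_dilate_def)
    then show ?thesis using card_image_le[OF fT] by simp
  qed
  have "real (card T) * (2 / 7) = (\<Sum>b\<in>T. 2 / 7)" by simp
  also have "\<dots> \<le> (\<Sum>b\<in>T. 1 - cos (2 * pi * real \<xi> * real_of_int b / real p))"
  proof (rule sum_mono)
    fix b assume b: "b \<in> T"
    define x where "x = centered_residue (int p) (int \<xi> * b)"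
    have "int p dvd int \<xi> * b - x"
      using centered_residue_cong[of "int p" "int \<xi> * b"] by (metis mod_eq_dvd_iff x_def)
    then obtain j where "int \<xi> * b - x = int p * j" by blast
    then have "real_of_int (int \<xi> * b) = real_of_int (x + int p * j)" by (simp add: algebra_simps)
    then have eq: "real \<xi> * real_of_int b = real_of_int x + real p * real_of_int j" by simp
    have "2 * pi * real \<xi> * real_of_int b / real p = 2 * pi * (real \<xi> * real_of_int b) / real p" by simp
    also have "\<dots> = 2 * pi * real_of_int x / real p + 2 * pi * real_of_int j"
      unfolding eq using p_pos by (simp add: field_simps)
    finally have "cos (2 * pi * real \<xi> * real_of_int b / real p) = cos (2 * pi * real_of_int x / real p)"
      by (simp add: cos_add)
    moreover have "2 / 7 \<le> 1 - cos (2 * pi * real_of_int x / real p)"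
      using b p_pos abs_centered_residue[OF odd_int p_pos, of "int \<xi> * b"]
      by (intro one_minus_cos_ge) (auto simp: T_def x_def)
    ultimately show "2 / 7 \<le> 1 - cos (2 * pi * real \<xi> * real_of_int b / real p)" by simp
  qed
  also have "\<dots> \<le> (\<Sum>b\<in>E. 1 - cos (2 * pi * real \<xi> * real_of_int b / real p))"
    by (rule sum_mono2) (use fin in \<open>auto simp: T_def\<close>)
  finally have "real (card A) * (real (card T) * (2 / 7)) \<le> 2 * real (\<Sum>b\<in>E. mod_exits (int p) A b)"
    using \<xi>(2) by (meson mult_left_mono of_nat_0_le_iff order_trans)
  also have "(\<Sum>b\<in>E. mod_exits (int p) A b) \<le> (2 * n + 1) * n"
    using sum_bounded_above[of E "mod_exits (int p) A" n] \<Delta> card by simp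
  finally have "real (card A) * (real (card T) * (2 / 7)) \<le> 2 * real ((2 * n + 1) * n)" by simp
  moreover have "real (1000 * n) \<le> real (card A)" using A(3) by (simp only: of_nat_le_iff)
  then have "real (1000 * n) * (real (card T) * (2 / 7)) \<le> real (card A) * (real (card T) * (2 / 7))"
    by (rule mult_right_mono) simp
  ultimately have "real n * (1000 * real (card T)) \<le> real n * (7 * real (2 * n + 1))"
    by (simp add: algebra_simps)
  then have "1000 * real (card T) \<le> 7 * real (2 * n + 1)" using A(4) by (simp add: mult_le_cancel_left)
  then have "1000 * card T \<le> 7 * (2 * n + 1)" by linarith
  then show ?thesis using cT u by (intro exI[of _ "int \<xi>"]) simp
qed

text \<open>All elements of \<open>E + E\<close> have at most \<open>2 * n\<close> exits, so
  \<open>card_few_exits_less\<close> applies with \<open>t = 2 * n\<close>.\<close>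

lemma card_sumset_less:
  assumes A: "A \<subseteq> {0..<int p}" "2 * card A < p" "1000 * n \<le> card A" "n > 0"
    and \<Delta>: "\<And>b. b \<in> E \<Longrightarrow> mod_exits (int p) A b \<le> n"
  shows "5 * (int (card (mod_sumset (int p) E E)) - 1) < 22 * int n"
proof -
  have "5 * (int (card (mod_sumset (int p) E E)) - 1) < 11 * int (2 * n)"
  proof (rule card_few_exits_less[OF prime A(1,2)])
    show "mod_sumset (int p) E E \<subseteq> few_exits (int p) A (2 * n)"
    proof
      fix z assume "z \<in> mod_sumset (int p) E E"
      then obtain x y where xy: "x \<in> E" "y \<in> E" "z = (x + y) mod int p" by (rule mod_sumsetE)
      have "mod_exits (int p) A z \<le> mod_exits (int p) A x + mod_exits (int p) A y"
        unfolding xy(3) mod_exits_mod by (rule mod_exits_add[OF p_pos A(1)])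
      also have "\<dots> \<le> 2 * n" using \<Delta>[OF xy(1)] \<Delta>[OF xy(2)] by simp
      finally show "z \<in> few_exits (int p) A (2 * n)" using xy(3) p_pos by (simp add: few_exits_def)
    qed
    show "0 \<in> mod_sumset (int p) E E" using mod_sumsetI[OF zero zero, of "int p"] by simp
  qed (use A in auto)
  then show ?thesis by simp
qed

text \<open>If \<open>y\<close> is congruent to no element of \<open>3 E0\<close>, then \<open>y + E0\<close> is disjoint from
  \<open>E0 + E0\<close>, and \<open>E + E\<close> becomes too large. Hence a large cluster confines all residues.\<close>

lemma residues_in_short_progression:
  assumes A: "A \<subseteq> {0..<int p}" "2 * card A < p" "1000 * n \<le> card A" "n > 0"
    and \<Delta>: "\<And>b. b \<in> E \<Longrightarrow> mod_exits (int p) A b \<le> n"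
  shows "\<exists>u. \<not> int p dvd u \<and> (\<forall>e\<in>ER u. 5 * \<bar>e\<bar> \<le> 7 * int n)"
proof -
  let ?p = "int p"
  define \<sigma> where "\<sigma> = int (card (mod_sumset ?p E E))"
  have \<sigma>: "5 * (\<sigma> - 1) < 22 * int n" unfolding \<sigma>_def by (rule card_sumset_less[OF A \<Delta>])
  have p_big: "2000 * int n < ?p" using A(2,3) by linarith
  obtain w where w: "\<not> ?p dvd w" "1000 * card {e \<in> ER w. ?p \<le> 8 * \<bar>e\<bar>} \<le> 7 * (2 * n + 1)"
    using exists_large_cluster[OF A \<Delta>] by blast
  \<comment> \<open>The bound \<open>p / 8\<close> keeps sums of two cluster elements from wrapping
    around modulo \<open>p\<close>.\<close>
  define E0 where "E0 = {e \<in> ER w. 8 * \<bar>e\<bar> < ?p}"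
  define k where "k = int (card {e \<in> E0. e > 0})"
  have E0: "finite E0" "0 \<in> E0" "\<And>e. e \<in> E0 \<Longrightarrow> - e \<in> E0"
    using finite_ER zero_ER sym_ER p_pos by (auto simp: E0_def)
  have cE0: "int (card E0) = 2 * k + 1" using card_symmetric_set[OF E0] by (simp add: k_def)
  have "card (ER w) = card E0 + card {e \<in> ER w. ?p \<le> 8 * \<bar>e\<bar>}"
  proof -
    have "ER w = E0 \<union> {e \<in> ER w. ?p \<le> 8 * \<bar>e\<bar>}" by (auto simp: E0_def)
    then have "card (ER w) = card (E0 \<union> {e \<in> ER w. ?p \<le> 8 * \<bar>e\<bar>})" by simp
    also have "\<dots> = card E0 + card {e \<in> ER w. ?p \<le> 8 * \<bar>e\<bar>}"
      by (rule card_Un_disjoint) (use finite_ER[of w] E0(1) in \<open>auto simp: E0_def\<close>)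
    finally show ?thesis .
  qed
  moreover define \<beta> where "\<beta> = card {e \<in> ER w. ?p \<le> 8 * \<bar>e\<bar>}"
  ultimately have "2 * int n = 2 * k + int \<beta>"
    using card_ER[OF w(1)] cE0 by linarith
  then have "2000 * k = 2000 * int n - 1000 * int \<beta>" by simp
  moreover have "1000 * int \<beta> \<le> 7 * (2 * int n + 1)"
    using of_nat_mono[OF w(2), where 'a = int] by (simp add: \<beta>_def)
  moreover have "int n \<ge> 1" using A(4) by simp
  \<comment> \<open>For \<open>n \<ge> 1\<close> the loss \<open>7 * (2 * n + 1)\<close> is at most
    \<open>21 * n\<close>.\<close>
  ultimately have k: "2000 * k \<ge> 1979 * int n" by simp
  define s0 where "s0 = int (card ((\<lambda>(a, b). a + b) ` (E0 \<times> E0)))"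
  have "card ((\<lambda>(a, b). a + b) ` (E0 \<times> E0)) \<le> card (mod_sumset ?p (ER w) (ER w))"
    by (rule card_int_sumset_le[OF p_pos finite_ER]) (auto simp: E0_def)
  then have s0: "s0 \<le> \<sigma>" using card_sumset_ER[of w] by (simp add: s0_def \<sigma>_def)
  have kpos: "k > 0" using k A(4) by linarith
  \<comment> \<open>\<open>2 * s0 - 2\<close> is below \<open>8.8 * n\<close>, while
    \<open>9 * k\<close> is at least \<open>8.9 * n\<close>.\<close>
  have "2 * s0 < 9 * k + 2" using s0 \<sigma> k A(4) by simp
  from symmetric_small_doubling[OF E0 cE0 kpos s0_def[symmetric] this]
  obtain d l where dl: "d > 0" "l \<le> s0 - 3 * k - 1" "\<exists>e\<in>E0. d \<le> e"
    "\<And>e. e \<in> E0 \<Longrightarrow> d dvd e \<and> \<bar>e\<bar> \<le> d * l" by blast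
  have dp: "d < ?p" using dl(3) p_pos by (auto simp: E0_def)
  have quot: "\<exists>c. e = d * c \<and> \<bar>c\<bar> \<le> l" if e: "e \<in> E0" for e
  proof -
    obtain c where c: "e = d * c" using dl(4)[OF e] by blast
    have "d * \<bar>c\<bar> \<le> d * l" using dl(4)[OF e] dl(1) by (simp add: c abs_mult)
    then show ?thesis using c dl(1) by auto
  qed
  have l: "k \<le> l"
  proof -
    have "E0 \<subseteq> (\<lambda>c. d * c) ` {- l..l}"
    proof
      fix e assume "e \<in> E0"
      then obtain c where "e = d * c" "\<bar>c\<bar> \<le> l" using quot by blast
      then show "e \<in> (\<lambda>c. d * c) ` {- l..l}" by (intro image_eqI[of _ _ c]) auto
    qed
    then have "card E0 \<le> card ((\<lambda>c. d * c) ` {- l..l})" by (intro card_mono) auto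
    also have "\<dots> \<le> card {- l..l}" by (rule card_image_le) simp
    also have "\<dots> = nat (2 * l + 1)" by simp
    finally show ?thesis using cE0 kpos by linarith
  qed
  have l_small: "l \<le> 2 * int n" using dl(2) s0 \<sigma> k by simp
  obtain v where v: "(v * d) mod ?p = 1 mod ?p" "\<not> ?p dvd v"
    using unit_inverse_mod[OF prime dl(1) dp] by blast
  define u where "u = v * w"
  have u: "\<not> ?p dvd u" using v(2) w(1) prime by (simp add: u_def prime_dvd_mult_iff)
  have small: "\<bar>x\<bar> \<le> 3 * l" if x: "x \<in> ER u" for x
  proof -
    obtain b where b: "b \<in> E" "x = centered_residue ?p (u * b)"
      using x by (auto simp: centered_dilate_def)
    define y where "y = centered_residue ?p (w * b)"
    have y: "y \<in> ER w" using b(1) by (simp add: y_def centered_dilate_def)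
    let ?P = "(\<lambda>z. (z + y) mod ?p) ` (\<lambda>z. z mod ?p) ` E0"
    let ?Q = "(\<lambda>z. z mod ?p) ` (\<lambda>(a, b). a + b) ` (E0 \<times> E0)"
    have "?P \<inter> ?Q \<noteq> {}"
    proof
      assume disj: "?P \<inter> ?Q = {}"
      have "?P \<union> ?Q \<subseteq> mod_sumset ?p (ER w) (ER w)"
      proof -
        have "?Q \<subseteq> mod_sumset ?p (ER w) (ER w)" by (auto simp: E0_def intro: mod_sumsetI)
        moreover have "?P \<subseteq> mod_sumset ?p (ER w) (ER w)"
        proof
          fix z assume "z \<in> ?P"
          then obtain e where e: "e \<in> E0" "z = (e + y) mod ?p" by (auto simp: mod_simps)
          show "z \<in> mod_sumset ?p (ER w) (ER w)"
            unfolding e(2) by (rule mod_sumsetI) (use e(1) y in \<open>auto simp: E0_def\<close>)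
        qed
        ultimately show ?thesis by blast
      qed
      then have "card (?P \<union> ?Q) \<le> card (mod_sumset ?p (ER w) (ER w))"
        using finite_ER by (intro card_mono) (auto simp: mod_sumset_def)
      moreover have "card (?P \<union> ?Q) = card ?P + card ?Q"
        by (rule card_Un_disjoint[OF _ _ disj]) (use E0(1) in auto)
      moreover have "card ?P = card E0"
      proof -
        have "card ?P = card ((\<lambda>z. z mod ?p) ` E0)"
          by (rule card_image_add_mod[OF p_pos]) (use p_pos in auto)
        also have "\<dots> = card E0"
        proof (rule card_image, rule inj_onI)
          fix a b assume ab: "a \<in> E0" "b \<in> E0" "a mod ?p = b mod ?p"
          show "a = b" by (rule eq_if_cong_and_small[OF ab(3)]) (use ab(1,2) in \<open>auto simp: E0_def\<close>)
        qed
        finally show ?thesis .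
      qed
      moreover have "card ?Q = card ((\<lambda>(a, b). a + b) ` (E0 \<times> E0))"
      proof (rule card_image, rule inj_onI)
        fix a b assume ab: "a \<in> (\<lambda>(a, b). a + b) ` (E0 \<times> E0)" "b \<in> (\<lambda>(a, b). a + b) ` (E0 \<times> E0)"
          "a mod ?p = b mod ?p"
        show "a = b" by (rule eq_if_cong_and_small[OF ab(3)]) (use ab(1,2) in \<open>auto simp: E0_def\<close>)
      qed
      \<comment> \<open>Since \<open>s0 \<ge> l + 3 * k + 1\<close> and \<open>l \<ge> k\<close>,
        this would give \<open>\<sigma> \<ge> 6 * k + 2\<close>, far above the bound of about
        \<open>4.4 * n\<close>.\<close>
      ultimately have "2 * k + 1 + s0 \<le> \<sigma>"
        using card_sumset_ER[of w] cE0 by (simp add: s0_def \<sigma>_def)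
      then show False using dl(2) l \<sigma> k by simp
    qed
    then obtain e a c where eac: "e \<in> E0" "a \<in> E0" "c \<in> E0" "(e mod ?p + y) mod ?p = (a + c) mod ?p"
      by auto
    obtain e' a' c' where e': "e = d * e'" "a = d * a'" "c = d * c'" "\<bar>e'\<bar> \<le> l" "\<bar>a'\<bar> \<le> l" "\<bar>c'\<bar> \<le> l"
      using quot[OF eac(1)] quot[OF eac(2)] quot[OF eac(3)] by blast
    have "y mod ?p = ((e mod ?p + y) mod ?p - e) mod ?p" by (simp add: mod_simps)
    also have "\<dots> = ((a + c) mod ?p - e) mod ?p" by (simp only: eac(4))
    also have "\<dots> = (d * (a' + c' - e')) mod ?p"
      unfolding e'(1-3) by (simp add: mod_simps algebra_simps)
    finally have "(v * w * b) mod ?p = (a' + c' - e') mod ?p"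
      by (rule cong_ER[OF b(1) v(1) y_def])
    note eq = this[symmetric]
    have abs: "\<bar>a' + c' - e'\<bar> \<le> 3 * l" using e'(4-6) by linarith
    have "2 * \<bar>a' + c' - e'\<bar> \<le> 2 * (3 * l)" using abs by simp
    also have "\<dots> \<le> 12 * int n" using l_small by simp
    also have "\<dots> \<le> 2000 * int n" by simp
    also note p_big
    finally have half: "2 * \<bar>a' + c' - e'\<bar> < ?p" .
    have "x = a' + c' - e'"
      unfolding b(2) u_def
      by (rule centered_residue_unique[OF odd_int p_pos eq half])
    then show ?thesis using abs by simp
  qed
  \<comment> \<open>Now the whole dilate lies within \<open>3 * l \<le> 6 * n\<close> of
    \<open>0\<close>, so \<open>symmetric_small_doubling\<close> applies to all of it. The resulting
    length is at most \<open>s1 - 3 * n - 1\<close>, and \<open>22 / 5 - 3\<close> is the constant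
    \<open>7 / 5\<close>.\<close>
  define s1 where "s1 = int (card ((\<lambda>(a, b). a + b) ` (ER u \<times> ER u)))"
  have "card ((\<lambda>(a, b). a + b) ` (ER u \<times> ER u)) \<le> card (mod_sumset ?p (ER u) (ER u))"
  proof (rule card_int_sumset_le[OF p_pos finite_ER order.refl])
    fix e assume "e \<in> ER u"
    then show "4 * \<bar>e\<bar> < ?p" using small[of e] l_small p_big by simp
  qed
  then have s1: "s1 \<le> \<sigma>" using card_sumset_ER[of u] by (simp add: s1_def \<sigma>_def)
  have c1: "int (card (ER u)) = 2 * int n + 1" using card_ER[OF u] by simp
  have n0: "int n > 0" using A(4) by simp
  have "2 * s1 < 9 * int n + 2" using s1 \<sigma> by simp
  from symmetric_small_doubling[OF finite_ER zero_ER sym_ER c1 n0 s1_def[symmetric] this]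
  obtain d1 l1 where dl1: "d1 > 0" "l1 \<le> s1 - 3 * int n - 1" "\<exists>e\<in>ER u. d1 \<le> e"
    "\<And>e. e \<in> ER u \<Longrightarrow> d1 dvd e \<and> \<bar>e\<bar> \<le> d1 * l1" by blast
  have dp1: "d1 < ?p" using dl1(3) abs_ER[of _ u] by force
  obtain v1 where v1: "(v1 * d1) mod ?p = 1 mod ?p" "\<not> ?p dvd v1"
    using unit_inverse_mod[OF prime dl1(1) dp1] by blast
  have l1: "5 * l1 \<le> 7 * int n" using dl1(2) s1 \<sigma> by simp
  have "5 * \<bar>x\<bar> \<le> 7 * int n" if x: "x \<in> ER (v1 * u)" for x
  proof -
    obtain b where b: "b \<in> E" "x = centered_residue ?p (v1 * u * b)"
      using x by (auto simp: centered_dilate_def)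
    define y where "y = centered_residue ?p (u * b)"
    have y: "y \<in> ER u" using b(1) by (simp add: y_def centered_dilate_def)
    obtain c where c: "y = d1 * c" using dl1(4)[OF y] by blast
    have "d1 * \<bar>c\<bar> \<le> d1 * l1" using dl1(4)[OF y] dl1(1) by (simp add: c abs_mult)
    then have cl: "\<bar>c\<bar> \<le> l1" using dl1(1) by simp
    have "(v1 * u * b) mod ?p = c mod ?p"
      by (rule cong_ER[OF b(1) v1(1) y_def]) (simp add: c)
    note eq = this[symmetric]
    have "x = c"
      unfolding b(2) by (rule centered_residue_unique[OF odd_int p_pos eq]) (use cl l1 p_big in simp)
    then show ?thesis using cl l1 by simp
  qed
  moreover have "\<not> ?p dvd v1 * u" using v1(2) u prime by (simp add: prime_dvd_mult_iff)
  ultimately show ?thesis by blast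
qed

end

subsection \<open>Passage to the integers\<close>

lemma mod_exits_dilate:
  fixes p :: nat and u :: int
  assumes p: "prime p" and u: "\<not> int p dvd u" and A: "A \<subseteq> {0..<int p}"
  defines "A' \<equiv> (\<lambda>a. (u * a) mod int p) ` A"
  shows "A' \<subseteq> {0..<int p}" "card A' = card A"
    "c mod int p = (u * b) mod int p \<Longrightarrow> mod_exits (int p) A' c = mod_exits (int p) A b"
proof -
  have p0: "int p > 0" using p prime_gt_0_nat by simp
  have inj: "inj_on (\<lambda>a. (u * a) mod int p) {0..<int p}"
  proof (rule inj_onI)
    fix x y assume xy: "x \<in> {0..<int p}" "y \<in> {0..<int p}" "(u * x) mod int p = (u * y) mod int p"
    then have "int p dvd u * (x - y)" by (simp add: mod_eq_dvd_iff algebra_simps)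
    then have "x mod int p = y mod int p" using u p by (simp add: prime_dvd_mult_iff mod_eq_dvd_iff)
    then show "x = y" using xy by simp
  qed
  show "A' \<subseteq> {0..<int p}" using p0 by (auto simp: A'_def)
  show "card A' = card A" unfolding A'_def by (rule card_image) (rule inj_on_subset[OF inj A])
  show "mod_exits (int p) A' c = mod_exits (int p) A b" if c: "c mod int p = (u * b) mod int p"
  proof -
    have mem: "(u * a) mod int p \<in> A' \<longleftrightarrow> a mod int p \<in> A" for a
    proof
      assume "(u * a) mod int p \<in> A'"
      then obtain a' where a': "a' \<in> A" "(u * a) mod int p = (u * a') mod int p" by (auto simp: A'_def)
      have "(u * (a mod int p)) mod int p = (u * a') mod int p" using a'(2) by (simp add: mod_simps)
      moreover have "a mod int p \<in> {0..<int p}" "a' \<in> {0..<int p}" using p0 a'(1) A by auto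
      ultimately have "a mod int p = a'" using inj by (blast dest: inj_onD)
      then show "a mod int p \<in> A" using a'(1) by simp
    next
      assume "a mod int p \<in> A"
      then have "(u * (a mod int p)) mod int p \<in> A'" unfolding A'_def by (rule imageI)
      then show "(u * a) mod int p \<in> A'" by (simp add: mod_simps)
    qed
    have "((u * a) mod int p + c) mod int p = (u * (a + b)) mod int p" for a
    proof -
      have "((u * a) mod int p + c) mod int p = (u * a + c mod int p) mod int p" by (simp add: mod_simps)
      also have "\<dots> = (u * (a + b)) mod int p" unfolding c by (simp add: mod_simps algebra_simps)
      finally show ?thesis .
    qed
    then have "{x \<in> A'. (x + c) mod int p \<notin> A'} = (\<lambda>a. (u * a) mod int p) ` {a \<in> A. (a + b) mod int p \<notin> A}"
      using mem by (auto simp: A'_def[symmetric]) (auto simp: A'_def)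
    moreover have "inj_on (\<lambda>a. (u * a) mod int p) {a \<in> A. (a + b) mod int p \<notin> A}"
      by (rule inj_on_subset[OF inj]) (use A in auto)
    ultimately show ?thesis unfolding mod_exits_def by (simp add: card_image)
  qed
qed

text \<open>Every element outside \<open>A\<close> is at distance less than \<open>q\<close> after an exit of step \<open>1\<close>, unless
  there is a gap of length \<open>q\<close>.\<close>

lemma exists_gap:
  fixes p q :: int
  assumes p: "p > 0" and A: "A \<subseteq> {0..<p}" and q: "q > 0"
    and big: "int (mod_exits p A 1) * (q - 1) < p - int (card A)"
  shows "\<exists>g. \<forall>i\<in>{0..<q}. (g + i) mod p \<notin> A"
proof (rule ccontr)
  assume "\<not> ?thesis"
  then have meet: "\<exists>i\<in>{0..<q}. (g + i) mod p \<in> A" for g by blast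
  have fin: "finite A" using A finite_subset by blast
  define X where "X = {a \<in> A. (a + 1) mod p \<notin> A}"
  have "{0..<p} - A \<subseteq> (\<lambda>(a, i). (a + i) mod p) ` (X \<times> {1..q - 1})"
  proof
    fix z assume z: "z \<in> {0..<p} - A"
    define P where "P j \<longleftrightarrow> (z - int j) mod p \<in> A" for j :: nat
    obtain i where i: "i \<in> {0..<q}" "(z - (q - 1) + i) mod p \<in> A" using meet by blast
    then have ex: "P (nat (q - 1 - i))" by (auto simp: P_def algebra_simps)
    \<comment> \<open>The distance from \<open>z\<close> back to the nearest element of
      \<open>A\<close>. Minimality makes that element an exit of step \<open>1\<close>.\<close>
    define j where "j = (LEAST j. P j)"
    have Pj: "P j" unfolding j_def using ex by (rule LeastI)
    have jle: "j \<le> nat (q - 1 - i)" unfolding j_def using ex by (rule Least_le)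
    have zm: "z mod p = z" using z by (intro mod_pos_pos_trivial) auto
    have j0: "j \<noteq> 0"
    proof
      assume "j = 0"
      then show False using Pj z zm by (simp add: P_def)
    qed
    then have "\<not> P (j - 1)" unfolding j_def by (intro not_less_Least) simp
    then have "(z - int j + 1) mod p \<notin> A" using j0 by (simp add: P_def of_nat_diff algebra_simps)
    then have "((z - int j) mod p + 1) mod p \<notin> A" by (simp add: mod_simps)
    then have "(z - int j) mod p \<in> X" using Pj by (simp add: X_def P_def)
    moreover have "int j \<in> {1..q - 1}" using j0 jle i(1) by auto
    moreover have "z = ((z - int j) mod p + int j) mod p" by (simp add: mod_simps zm)
    ultimately show "z \<in> (\<lambda>(a, i). (a + i) mod p) ` (X \<times> {1..q - 1})" by force
  qed
  then have "card ({0..<p} - A) \<le> card ((\<lambda>(a, i). (a + i) mod p) ` (X \<times> {1..q - 1}))"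
    using fin by (intro card_mono) (auto simp: X_def)
  also have "\<dots> \<le> card (X \<times> {1..q - 1})"
    using fin by (intro card_image_le) (auto simp: X_def)
  also have "\<dots> = mod_exits p A 1 * nat (q - 1)" by (simp add: card_cartesian_product X_def mod_exits_def)
  finally have "int (card ({0..<p} - A)) \<le> int (mod_exits p A 1) * (q - 1)"
    using q by (metis int_nat_eq le_add_diff_inverse2 of_nat_le_iff of_nat_mult zle_diff1_eq diff_ge_0_iff_ge int_one_le_iff_zero_less)
  moreover have "card A \<le> card {0..<p}" using A by (intro card_mono) auto
  moreover have "card ({0..<p} - A) = card {0..<p} - card A" using A fin by (intro card_Diff_subset)
  ultimately show False using big p by simp
qed

text \<open>Cut the circle at the gap. A shift by at most \<open>q\<close> that leaves
  \<open>B\<close> either stays below \<open>g + p\<close>, where it misses \<open>A\<close> modulo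
  \<open>p\<close>, or lands in the next copy of the gap. So every exit from \<open>B\<close> is an
  exit modulo \<open>p\<close>.\<close>

lemma exists_unrolling:
  fixes p q :: int
  assumes p: "p > 0" and A: "A \<subseteq> {0..<p}" and q: "q > 0"
    and gap: "\<And>i. i \<in> {0..<q} \<Longrightarrow> (g + i) mod p \<notin> A" and qp: "q \<le> p"
  shows "\<exists>B. finite B \<and> card B = card A \<and>
    (\<forall>x\<in>{1..q}. card {b \<in> B. b + x \<notin> B} \<le> mod_exits p A x)"
proof -
  define B where "B = {x \<in> {g + q..<g + p}. x mod p \<in> A}"
  have fin: "finite A" using A finite_subset by blast
  have finB: "finite B" by (rule finite_subset[of _ "{g + q..<g + p}"]) (auto simp: B_def)
  have inj: "inj_on (\<lambda>x. x mod p) B"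
  proof (rule inj_onI)
    fix x y assume xy: "x \<in> B" "y \<in> B" "x mod p = y mod p"
    have "(x - g) mod p = (y - g) mod p" using xy(3) by (rule mod_diff_cong) simp
    moreover have "(x - g) mod p = x - g" "(y - g) mod p = y - g"
      using xy(1,2) q by (auto simp: B_def intro!: mod_pos_pos_trivial)
    ultimately show "x = y" by simp
  qed
  have "(\<lambda>x. x mod p) ` B = A"
  proof
    show "A \<subseteq> (\<lambda>x. x mod p) ` B"
    proof
      fix a assume a: "a \<in> A"
      define x where "x = g + (a - g) mod p"
      have xm: "x mod p = a" using a A by (simp add: x_def mod_simps subset_iff)
      have "0 \<le> (a - g) mod p" "(a - g) mod p < p" using p by auto
      moreover have "\<not> (a - g) mod p < q"
      proof
        assume "(a - g) mod p < q"
        then have "(g + (a - g) mod p) mod p \<notin> A" using p by (intro gap) simp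
        then show False using xm a by (simp add: x_def)
      qed
      ultimately have "x \<in> B" using xm a by (simp add: B_def x_def)
      then show "a \<in> (\<lambda>x. x mod p) ` B" using xm by force
    qed
  qed (auto simp: B_def)
  then have cB: "card B = card A" using inj by (metis card_image)
  have "card {b \<in> B. b + x \<notin> B} \<le> mod_exits p A x" if x: "x \<in> {1..q}" for x
  proof -
    have "(b + x) mod p \<notin> A" if b: "b \<in> B" "b + x \<notin> B" for b
    proof (cases "b + x < g + p")
      case True
      then show ?thesis using b x by (auto simp: B_def)
    next
      case False
      then have "(g + (b + x - p - g)) mod p \<notin> A" using b(1) x by (intro gap) (auto simp: B_def)
      moreover have "g + (b + x - p - g) = b + x - p" by simp
      ultimately show ?thesis by (metis minus_mod_self2)
    qed
    then have "(\<lambda>b. b mod p) ` {b \<in> B. b + x \<notin> B} \<subseteq> {a \<in> A. (a + x) mod p \<notin> A}"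
    proof -
      assume *: "\<And>b. b \<in> B \<Longrightarrow> b + x \<notin> B \<Longrightarrow> (b + x) mod p \<notin> A"
      have "b mod p \<in> A" "(b mod p + x) mod p \<notin> A" if "b \<in> B" "b + x \<notin> B" for b
        using *[OF that] that(1) by (simp_all add: B_def mod_simps)
      then show ?thesis by blast
    qed
    then have "card ((\<lambda>b. b mod p) ` {b \<in> B. b + x \<notin> B}) \<le> mod_exits p A x"
      unfolding mod_exits_def using fin by (intro card_mono) auto
    moreover have "card ((\<lambda>b. b mod p) ` {b \<in> B. b + x \<notin> B}) = card {b \<in> B. b + x \<notin> B}"
      by (rule card_image) (rule inj_on_subset[OF inj], auto)
    ultimately show ?thesis by simp
  qed
  then show ?thesis using finB cB by blast
qed

lemma (in symmetric_residues) mod_few_exits_bound: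
  assumes A: "A \<subseteq> {0..<int p}" "2 * card A < p" "1000 * n \<le> card A" "n > 0" "8 * n\<^sup>2 < p"
    and \<Delta>: "\<And>b. b \<in> E \<Longrightarrow> mod_exits (int p) A b < n" and k: "n \<le> 3 ^ k"
  shows "5 * int (card A) \<le> 28 * int n * (7 * int k + 3)"
proof -
  let ?p = "int p"
  obtain u where u: "\<not> ?p dvd u" "\<And>e. e \<in> ER u \<Longrightarrow> 5 * \<bar>e\<bar> \<le> 7 * int n"
    using residues_in_short_progression[OF A(1-4) less_imp_le[OF \<Delta>]] by blast
  define A' where "A' = (\<lambda>a. (u * a) mod ?p) ` A"
  have A': "A' \<subseteq> {0..<?p}" "card A' = card A"
    unfolding A'_def by (rule mod_exits_dilate[OF prime u(1) A(1)])+
  have \<Delta>': "mod_exits ?p A' e < n" if e: "e \<in> ER u" for e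
  proof -
    obtain b where b: "b \<in> E" "e = centered_residue ?p (u * b)" using e by (auto simp: centered_dilate_def)
    have "mod_exits ?p A' e = mod_exits ?p A b"
      unfolding A'_def by (rule mod_exits_dilate(3)[OF prime u(1) A(1)]) (simp add: b(2) centered_residue_cong)
    then show ?thesis using \<Delta>[OF b(1)] by simp
  qed
  define X where "X = {e \<in> ER u. e > 0}"
  have cX: "card X = n"
    using card_symmetric_set[OF finite_ER zero_ER sym_ER, of u] card_ER[OF u(1)] by (simp add: X_def)
  have fX: "finite X" "X \<noteq> {}" using cX A(4) by (auto intro: card_ge_0_finite)
  define q where "q = Max X"
  have q: "q \<in> X" unfolding q_def using fX by (rule Max_in)
  have Xq: "X \<subseteq> {1..q}" using fX by (auto simp: X_def q_def)
  have q0: "q > 0" using q by (simp add: X_def)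
  have q5: "5 * q \<le> 7 * int n" using u(2)[of q] q by (auto simp: X_def)
  have ERq: "ER u \<subseteq> {- q..q}"
  proof
    fix e assume e: "e \<in> ER u"
    have "e \<le> q" using e fX q0 Max_ge[of X e] by (cases "e > 0") (auto simp: X_def q_def)
    moreover have "- e \<le> q" using sym_ER[OF e] fX q0 Max_ge[of X "- e"] by (cases "- e > 0") (auto simp: X_def q_def)
    ultimately show "e \<in> {- q..q}" by simp
  qed
  \<comment> \<open>Two sets of \<open>2 * n + 1\<close> points cannot be disjoint in an interval of
    \<open>2 * q + 2\<close> points when \<open>5 * q \<le> 7 * n\<close>. Thus \<open>1\<close> is
    a difference of two elements of the dilate and has fewer than \<open>2 * n\<close>
    exits.\<close>
  have "ER u \<inter> (\<lambda>e. e + 1) ` ER u \<noteq> {}"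
  proof
    assume "ER u \<inter> (\<lambda>e. e + 1) ` ER u = {}"
    then have "card (ER u \<union> (\<lambda>e. e + 1) ` ER u) = card (ER u) + card ((\<lambda>e. e + 1) ` ER u)"
      using finite_ER by (intro card_Un_disjoint) auto
    also have "\<dots> = 4 * n + 2" using card_ER[OF u(1)] by (simp add: card_image)
    finally have "card (ER u \<union> (\<lambda>e. e + 1) ` ER u) = 4 * n + 2" .
    moreover have "card (ER u \<union> (\<lambda>e. e + 1) ` ER u) \<le> card {- q..q + 1}"
      using ERq by (intro card_mono) auto
    ultimately have "4 * int n + 2 \<le> 2 * q + 2" using q0 by simp
    then show False using q5 A(4) by simp
  qed
  then obtain b where "b \<in> ER u" "b + 1 \<in> ER u" by auto
  then obtain a where ab: "a \<in> ER u" "b \<in> ER u" "a + - b = 1" by force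
  have "mod_exits ?p A' (a + - b) \<le> mod_exits ?p A' a + mod_exits ?p A' (- b)"
    by (rule mod_exits_add[OF p_pos A'(1)])
  then have \<Delta>1: "mod_exits ?p A' 1 < 2 * n"
    using \<Delta>'[OF ab(1)] \<Delta>'[OF ab(2)] mod_exits_uminus[OF A'(1), of b] ab(3) by simp
  have "5 * (int (mod_exits ?p A' 1) * (q - 1)) \<le> int (mod_exits ?p A' 1) * (7 * int n)"
    using mult_left_mono[of "5 * (q - 1)" "7 * int n" "int (mod_exits ?p A' 1)"] q5 by (simp add: algebra_simps)
  also have "\<dots> \<le> (2 * int n) * (7 * int n)" using \<Delta>1 by (intro mult_right_mono) auto
  also have "\<dots> \<le> 5 * (4 * (int n)\<^sup>2)" by (simp add: power2_eq_square)
  finally have "int (mod_exits ?p A' 1) * (q - 1) \<le> 4 * (int n)\<^sup>2" by (simp add: mult.commute)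
  moreover have "8 * (int n)\<^sup>2 < ?p" using A(5) by (metis of_nat_less_iff of_nat_mult of_nat_numeral of_nat_power)
  \<comment> \<open>The product is at most \<open>4 * n\<^sup>2\<close>, which is below
    \<open>p / 2\<close> by \<open>8 * n\<^sup>2 < p\<close>, and more than \<open>p / 2\<close>
    residues lie outside \<open>A'\<close>.\<close>
  ultimately have "int (mod_exits ?p A' 1) * (q - 1) < ?p - int (card A')"
    using A(2) A'(2) by linarith
  then obtain g where g: "\<And>i. i \<in> {0..<q} \<Longrightarrow> (g + i) mod ?p \<notin> A'"
    using exists_gap[OF p_pos A'(1) q0] by blast
  have "q \<le> ?p" using q5 A(2,3) by simp
  then obtain B where B: "finite B" "card B = card A'"
    "\<And>x. x \<in> {1..q} \<Longrightarrow> card {b \<in> B. b + x \<notin> B} \<le> mod_exits ?p A' x"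
    using exists_unrolling[OF p_pos A'(1) q0 g] by blast
  have "int (card B) \<le> 4 * q * (7 * int k + 3)"
  proof (rule int_few_exits_bound[OF B(1) Xq cX q _ _ k])
    fix x assume x: "x \<in> X"
    then show "card {b \<in> B. b + x \<notin> B} < n"
      using B(3)[of x] Xq \<Delta>'[of x] by (force simp: X_def)
  qed (use q5 in simp)
  then have "5 * int (card A) \<le> (5 * q) * (4 * (7 * int k + 3))" using B(2) A'(2) by (simp add: algebra_simps)
  also have "\<dots> \<le> (7 * int n) * (4 * (7 * int k + 3))" by (rule mult_right_mono[OF q5]) simp
  finally show ?thesis by (simp add: mult_ac)
qed

subsection \<open>Exits bounded by the size of the shift set\<close>

lemma carrier_mod_prime: "prime p \<Longrightarrow> carrier (integer_mod_group p) = {0..<int p}"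
  using prime_gt_0_nat[of p] by (simp add: carrier_integer_mod_group)

lemma shift_delta_eq_mod_exits:
  assumes p: "prime p" and A: "A \<subseteq> {0..<int p}"
  shows "shift_delta (integer_mod_group p) A b = mod_exits (int p) A b"
proof -
  have p0: "int p > 0" using p prime_gt_0_nat by simp
  have "(A #>\<^bsub>integer_mod_group p\<^esub> b) - A = (\<lambda>a. (a + b) mod int p) ` {a \<in> A. (a + b) mod int p \<notin> A}"
    using p0 by (auto simp: r_coset_def mult_integer_mod_group)
  moreover have "card ((\<lambda>a. (a + b) mod int p) ` {a \<in> A. (a + b) mod int p \<notin> A})
      = card {a \<in> A. (a + b) mod int p \<notin> A}"
    by (rule card_image_add_mod[OF p0]) (use A in auto)
  ultimately show ?thesis by (simp add: shift_delta_def mod_exits_def)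
qed

text \<open>As \<open>0\<close> is its own negative, the disjointness excludes it from
  \<open>B\<close>; hence \<open>B\<close>, \<open>- B\<close> and \<open>{0}\<close> contribute
  \<open>2 * card B + 1\<close> distinct residues.\<close>

lemma symmetric_residues_Un_uminus:
  fixes p :: nat
  assumes p: "prime p" "odd p" and B: "B \<subseteq> {0..<int p}" and disj: "\<And>b. b \<in> B \<Longrightarrow> (- b) mod int p \<notin> B"
  shows "symmetric_residues p (insert 0 (B \<union> uminus ` B)) (card B)"
proof
  have fin: "finite B" using B finite_subset by blast
  have B0: "0 \<notin> B" using disj[of 0] by auto
  show "prime p" "odd p" "finite (insert 0 (B \<union> uminus ` B))" "0 \<in> insert 0 (B \<union> uminus ` B)"
    using p fin by auto
  show "- e \<in> insert 0 (B \<union> uminus ` B)" if "e \<in> insert 0 (B \<union> uminus ` B)" for e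
    using that by auto
  have inj0: "inj_on (\<lambda>e. e mod int p) (B \<union> uminus ` B)"
  proof (rule inj_onI)
    have pos: "x = y" if "x \<in> B" "y \<in> B" "x mod int p = y mod int p" for x y
      using that B by (metis atLeastLessThan_iff mod_pos_pos_trivial subset_iff)
    have cross: False if "x \<in> B" "y \<in> B" "x mod int p = (- y) mod int p" for x y
    proof -
      have "x mod int p = x" using that(1) B by (intro mod_pos_pos_trivial) auto
      then show False using disj[OF that(2)] that(1,3) by simp
    qed
    fix x y assume xy: "x \<in> B \<union> uminus ` B" "y \<in> B \<union> uminus ` B" "x mod int p = y mod int p"
    consider "x \<in> B" "y \<in> B" | "x \<in> B" "- y \<in> B" | "- x \<in> B" "y \<in> B" | "- x \<in> B" "- y \<in> B"
      using xy(1,2) by auto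
    then show "x = y"
    proof cases
      case 1
      then show ?thesis using pos xy(3) by blast
    next
      case 2
      then show ?thesis using cross[of x "- y"] xy(3) by simp
    next
      case 3
      then show ?thesis using cross[of y "- x"] xy(3) by simp
    next
      case 4
      have "(- x) mod int p = (- y) mod int p" using xy(3) by (rule mod_minus_cong)
      then show ?thesis using pos[OF 4] by simp
    qed
  qed
  have nz: "e mod int p \<noteq> 0" if e: "e \<in> B \<union> uminus ` B" for e
  proof
    assume "e mod int p = 0"
    then have dvd: "int p dvd e" by auto
    obtain b where b: "b \<in> B" "e = b \<or> e = - b" using e by auto
    then have "int p dvd b" using dvd by auto
    moreover have "b mod int p = b" using b(1) B by (intro mod_pos_pos_trivial) auto
    ultimately show False using b(1) B0 by auto
  qed
  then show "inj_on (\<lambda>e. e mod int p) (insert 0 (B \<union> uminus ` B))"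
    using inj0 by (auto simp: inj_on_insert)
  have "B \<inter> uminus ` B = {}"
  proof (rule ccontr)
    assume "B \<inter> uminus ` B \<noteq> {}"
    then obtain b where b: "b \<in> B" "- b \<in> B" by auto
    then have "b \<in> {0..<int p}" "- b \<in> {0..<int p}" using B by blast+
    then have "b = 0" by simp
    then show False using b(1) B0 by simp
  qed
  then have "card (B \<union> uminus ` B) = 2 * card B"
    using fin by (simp add: card_Un_disjoint card_image)
  moreover have "0 \<notin> B \<union> uminus ` B" using nz by fastforce
  ultimately show "card (insert 0 (B \<union> uminus ` B)) = 2 * card B + 1"
    using fin by simp
qed

theorem theorem2:
  shows "\<exists>c::real. c > 0 \<and>
    (\<forall>(p::nat) A B.
       prime p \<longrightarrow>
       A \<subseteq> carrier (integer_mod_group p) \<longrightarrow>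
       B \<subseteq> carrier (integer_mod_group p) \<longrightarrow>
       1 < card A \<longrightarrow>
       real (card A) < real p / 2 \<longrightarrow>
       B \<inter> (set_inv\<^bsub>integer_mod_group p\<^esub> B) = {} \<longrightarrow>
       real (card B) < min (c * real (card A) / ln (real (card A))) (sqrt (real p / 8)) \<longrightarrow>
       shift_mu (integer_mod_group p) A B \<ge> card B)"
proof (intro exI[of _ "1 / 2000"] conjI allI impI)
  fix p A B
  assume p: "prime p" and "A \<subseteq> carrier (integer_mod_group p)" "B \<subseteq> carrier (integer_mod_group p)"
    and A1: "1 < card A" and A2: "real (card A) < real p / 2"
    and disj: "B \<inter> (set_inv\<^bsub>integer_mod_group p\<^esub> B) = {}"
    and n: "real (card B) < min (1 / 2000 * real (card A) / ln (real (card A))) (sqrt (real p / 8))"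
  then have AB: "A \<subseteq> {0..<int p}" "B \<subseteq> {0..<int p}" using carrier_mod_prime by auto
  define m where "m = real (card A)"
  define N where "N = real (card B)"
  have m2: "m \<ge> 2" using A1 by (simp add: m_def)
  have "ln 2 \<le> ln m" using m2 by simp
  \<comment> \<open>The inequality \<open>ln x \<le> x - 1\<close> at \<open>x = 1 / 2\<close> gives
    \<open>ln 2 \<ge> 1 / 2\<close>.\<close>
  then have lnm: "1 / 2 \<le> ln m" using ln_le_minus_one[of "1 / 2"] by (simp add: ln_div)
  have "N < 1 / 2000 * m / ln m" using n by (simp add: m_def N_def)
  then have small: "2000 * (N * ln m) < m" using lnm by (simp add: field_simps)
  show "card B \<le> shift_mu (integer_mod_group p) A B"
  proof (rule ccontr)
    assume neg: "\<not> card B \<le> shift_mu (integer_mod_group p) A B"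
    then have B0: "card B > 0" by simp
    then have finB: "finite B" "B \<noteq> {}" by (auto intro: card_ge_0_finite)
    have \<Delta>: "mod_exits (int p) A b < card B" if b: "b \<in> B" for b
    proof -
      have "shift_delta (integer_mod_group p) A b \<le> shift_mu (integer_mod_group p) A B"
        using finB b by (auto simp: shift_mu_def)
      then show ?thesis using neg by (simp add: shift_delta_eq_mod_exits[OF p AB(1)])
    qed
    have p2: "2 * card A < p" using A2 by linarith
    have "p > 2" using p2 A1 by simp
    then have "odd p" using p by (simp add: prime_odd_nat)
    have inv: "(- b) mod int p \<notin> B" if b: "b \<in> B" for b
    proof -
      have "inv\<^bsub>integer_mod_group p\<^esub> b = (- b) mod int p"
        using b \<open>B \<subseteq> carrier _\<close> by (intro inv_integer_mod_group) blast
      then have "(- b) mod int p \<in> set_inv\<^bsub>integer_mod_group p\<^esub> B"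
        unfolding SET_INV_def using b by force
      then show ?thesis using disj by blast
    qed
    interpret symmetric_residues p "insert 0 (B \<union> uminus ` B)" "card B"
      by (rule symmetric_residues_Un_uminus[OF p \<open>odd p\<close> AB(2) inv])
    have N1: "N \<ge> 1" using B0 by (simp add: N_def)
    have "N * (1 / 2) \<le> N * ln m" using lnm N1 by (intro mult_left_mono) auto
    \<comment> \<open>This determines the constant \<open>1 / 2000\<close>: with
      \<open>ln m \<ge> 1 / 2\<close> it guarantees the ratio \<open>1000\<close> required by the
      clustering argument.\<close>
    then have "1000 * N \<le> m" using small by linarith
    then have big: "1000 * card B \<le> card A" unfolding m_def N_def by linarith
    have "N < sqrt (real p / 8)" using n by (simp add: N_def)
    then have "N\<^sup>2 < (sqrt (real p / 8))\<^sup>2" using N1 by (intro power_strict_mono) auto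
    then have "N\<^sup>2 < real p / 8" by simp
    then have "real (8 * (card B)\<^sup>2) < real p" by (simp add: N_def)
    then have psq: "8 * (card B)\<^sup>2 < p" by (simp only: of_nat_less_iff)
    \<comment> \<open>The number of tripling steps:
      \<open>3 ^ k \<ge> exp (ln m) = m \<ge> N\<close>.\<close>
    define k where "k = nat \<lceil>ln m\<rceil>"
    have k: "ln m \<le> real k" "real k \<le> ln m + 1" using lnm by (auto simp: k_def)
    have "N \<le> m" using \<open>1000 * N \<le> m\<close> N1 by linarith
    also have "m = exp (ln m)" using m2 by simp
    also have "\<dots> \<le> exp (real k)" using k by simp
    also have "\<dots> = exp 1 ^ k" by (simp add: exp_of_nat_mult[symmetric])
    also have "\<dots> \<le> 3 ^ k" using exp_le by (intro power_mono) auto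
    finally have "real (card B) \<le> real (3 ^ k)" by (simp add: N_def)
    then have k3: "card B \<le> 3 ^ k" by (simp only: of_nat_le_iff)
    have "5 * int (card A) \<le> 28 * int (card B) * (7 * int k + 3)"
    proof (rule mod_few_exits_bound[OF AB(1) p2 big B0 psq _ k3])
      fix b assume "b \<in> insert 0 (B \<union> uminus ` B)"
      then show "mod_exits (int p) A b < card B"
        using \<Delta> B0 mod_exits_0[OF AB(1)] by (auto simp: mod_exits_uminus[OF AB(1)])
    qed
    then have "real_of_int (5 * int (card A)) \<le> real_of_int (28 * int (card B) * (7 * int k + 3))"
      by (simp only: of_int_le_iff)
    then have "5 * m \<le> 28 * N * (7 * real k + 3)" by (simp add: m_def N_def)
    \<comment> \<open>\<open>7 * k + 3\<close> is at most \<open>7 * ln m + 10\<close>, and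
      \<open>10 \<le> 20 * ln m\<close>.\<close>
    also have "\<dots> \<le> 28 * N * (27 * ln m)" using k(2) lnm N1 by (intro mult_left_mono) auto
    also have "\<dots> = 756 * (N * ln m)" by simp
    finally show False using small N1 lnm mult_nonneg_nonneg[of N "ln m"] m2 by linarith
  qed
qed simp

end
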